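(* Let $\mu,\nu$ be Borel probability measures on $\mathbb{R}$ with finite first moment and let $q$ be a Borel probability measure on $\mathbb{R}$ such that: (0) $\nu$ has mean $0$; (A1) $\nu$ and $q$ are absolutely continuous with respect to Lebesgue measure; (A2) the supports of $\nu$ and $q$ are intervals, and their densities are strictly positive Lebesgue-a.e. on the interior of their respective supports; (A3) there exist $a>1$ and $b>\frac{a}{a-1}$ such that $\nu$ has finite $a$-th moment and $q$ has finite $b$-th moment; (A4) there exists $\varsigma>1$ such that $Q_\nu'\in L^{\varsigma}(0,1)$ and the density $\rho_q$ of $q$ belongs to $L^{\max\left(\frac{2\varsigma-1}{\varsigma-1},\frac{a}{a-1}\right)}(\mathbb{R})$. If the pair $(\mu,\nu)$ is irreducible and $\mu$ is supported on finitely many atoms, then the Bass measure (of $q$-Bass martingales from $\mu$ to $\nu$) is unique up to translation; that is, any two Bass measures for $(\mu,\nu,q)$ are translates of each other.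
   Context: Notation. For a Borel probability measure $\xi$ on $\mathbb{R}$, $F_\xi$ is its cumulative distribution function and $Q_\xi(u)=\inf\{y\in\mathbb{R}:F_\xi(y)\ge u\}$, $u\in(0,1)$, its left-continuous quantile function, extended by $Q_\xi(0)=\inf(\mathrm{supp}(\xi))$, $Q_\xi(1)=\sup(\mathrm{supp}(\xi))$. $\alpha\ast q$ denotes the convolution of the measures $\alpha$ and $q$, and for a measurable function $T$, $(q\star T)(x)=\int_{\mathbb{R}}T(x+y)\,q(dy)$. $\mathscr{M}(\mu,\nu)$ is the set of martingale couplings of $\mu$ and $\nu$, i.e. probability measures $\pi(dx,dy)=\mu(dx)\pi_x(dy)$ on $\mathbb{R}^2$ with first marginal $\mu$, second marginal $\nu$ and $\int y\,\pi_x(dy)=x$ for $\mu$-a.e. $x$. $q$-Bass martingale and Bass measure. A measure $\pi\in\mathscr{M}(\mu,\nu)$ is called a $q$-Bass martingale (from $\mu$ to $\nu$) if there is a Borel probability measure $\alpha$ on $\mathbb{R}$ such that, with $T=Q_\nu\circ F_{\alpha\ast q}$ and $X_0\sim\alpha$, $Y\sim q$ independent, $\pi$ is the law of $(M_0,M_1)$ where $M_0=(q\star T)(X_0)$, $M_1=T(X_0+Y)$, and $q\star T$ is increasing $\alpha$-a.s., meaning strictly increasing on a Borel set of full $\alpha$-measure. Such an $\alpha$ is called a Bass measure. (The function $q\star T$ is defined $\alpha$-a.e.) Irreducibility. $\mu\preceq_c\nu$ (convex order) means $\int\varphi\,d\mu\le\int\varphi\,d\nu$ for every convex $\varphi:\mathbb{R}\to\mathbb{R}$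 for which both integrals are well-defined. For $\rho$ with finite first moment let $C_\rho(x)=\int_{\mathbb{R}}(y-x)^+\rho(dy)$. The pair $(\mu,\nu)$ is irreducible if $\mu\preceq_c\nu$ and the set $I=\{x\in\mathbb{R}:C_\mu(x)<C_\nu(x)\}$ is an interval with $\mu(I)=1$. *)

theory Defs
  imports "HOL-Probability.Probability"
begin

definition supp :: "real measure \<Rightarrow> real set" where
  "supp \<xi> = {x. \<forall>U. open U \<longrightarrow> x \<in> U \<longrightarrow> emeasure \<xi> U > 0}"

text \<open>The quantile function is extended-real valued because its values at 0 and 1 are the endpoints
  of the support, which may be infinite. The values outside the unit interval are irrelevant.\<close>

definition quantile :: "real measure \<Rightarrow> real \<Rightarrow> ereal" where
  "quantile \<xi> u =
     (if u \<le> 0 then Inf (ereal ` supp \<xi>)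
      else if 1 \<le> u then Sup (ereal ` supp \<xi>)
      else ereal (Inf {y. u \<le> cdf \<xi> y}))"

definition in_Lp :: "real \<Rightarrow> 'a measure \<Rightarrow> ('a \<Rightarrow> real) \<Rightarrow> bool" where
  "in_Lp p M f \<longleftrightarrow> f \<in> borel_measurable M \<and> integrable M (\<lambda>x. \<bar>f x\<bar> powr p)"

text \<open>\<open>quantile \<xi>\<close> is monotone and finite on (0,1), and its derivative is understood almost everywhere.\<close>

definition quantile_deriv_in_Lp :: "real \<Rightarrow> real measure \<Rightarrow> bool" where
  "quantile_deriv_in_Lp p \<xi> \<longleftrightarrow>
     (\<exists>g. (AE u in lborel. u \<in> {0<..<1} \<longrightarrow>
              ((\<lambda>v. real_of_ereal (quantile \<xi> v)) has_real_derivative g u) (at u))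
        \<and> in_Lp p (restrict_space lborel {0<..<1}) g)"

text \<open>Integrals with values in the extended reals, for integrands whose positive or negative part is
  integrable; note that \<open>ennreal\<close> truncates negative numbers to 0.\<close>

definition integral_well_defined :: "'a measure \<Rightarrow> ('a \<Rightarrow> real) \<Rightarrow> bool" where
  "integral_well_defined M f \<longleftrightarrow>
     (\<integral>\<^sup>+x. ennreal (f x) \<partial>M) < \<infinity> \<or> (\<integral>\<^sup>+x. ennreal (- f x) \<partial>M) < \<infinity>"

definition extended_integral :: "'a measure \<Rightarrow> ('a \<Rightarrow> real) \<Rightarrow> ereal" where
  "extended_integral M f =
     enn2ereal (\<integral>\<^sup>+x. ennreal (f x) \<partial>M) - enn2ereal (\<integral>\<^sup>+x. ennreal (- f x) \<partial>M)"

definition convex_order :: "real measure \<Rightarrow> real measure \<Rightarrow> bool" where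
  "convex_order \<mu> \<nu> \<longleftrightarrow>
     (\<forall>\<phi>. convex_on UNIV \<phi> \<longrightarrow> integral_well_defined \<mu> \<phi> \<longrightarrow> integral_well_defined \<nu> \<phi> \<longrightarrow>
          extended_integral \<mu> \<phi> \<le> extended_integral \<nu> \<phi>)"

definition call_function :: "real measure \<Rightarrow> real \<Rightarrow> real" where
  "call_function \<rho> x = (\<integral>y. max (y - x) 0 \<partial>\<rho>)"

definition irreducible_pair :: "real measure \<Rightarrow> real measure \<Rightarrow> bool" where
  "irreducible_pair \<mu> \<nu> \<longleftrightarrow>
     convex_order \<mu> \<nu> \<and>
     (let I = {x. call_function \<mu> x < call_function \<nu> x} in is_interval I \<and> emeasure \<mu> I = 1)"

text \<open>The kernel \<open>\<kappa>\<close> below is the disintegration of \<open>\<pi>\<close> with respect to its first marginal.\<close>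

definition martingale_couplings :: "real measure \<Rightarrow> real measure \<Rightarrow> (real \<times> real) measure set" where
  "martingale_couplings \<mu> \<nu> =
     {\<pi>. prob_space \<pi> \<and> sets \<pi> = sets (borel \<Otimes>\<^sub>M borel) \<and>
         distr \<pi> borel fst = \<mu> \<and> distr \<pi> borel snd = \<nu> \<and>
         (\<exists>\<kappa> \<in> measurable borel (prob_algebra borel).
            \<pi> = \<mu> \<bind> (\<lambda>x. \<kappa> x \<bind> (\<lambda>y. return (borel \<Otimes>\<^sub>M borel) (x, y))) \<and>
            (AE x in \<mu>. integrable (\<kappa> x) (\<lambda>y. y) \<and> (\<integral>y. y \<partial>\<kappa> x) = x))}"

text \<open>The function written \<open>q \<star> T\<close> in the literature, for extended-real valued \<open>T\<close>. It is meaningful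
  only at the points satisfying \<open>star_defined q T\<close>; elsewhere its value is arbitrary.\<close>

definition star_defined :: "real measure \<Rightarrow> (real \<Rightarrow> ereal) \<Rightarrow> real \<Rightarrow> bool" where
  "star_defined q T x \<longleftrightarrow>
     (AE y in q. \<bar>T (x + y)\<bar> \<noteq> \<infinity>) \<and> integrable q (\<lambda>y. real_of_ereal (T (x + y)))"

definition star :: "real measure \<Rightarrow> (real \<Rightarrow> ereal) \<Rightarrow> real \<Rightarrow> real" where
  "star q T x = (\<integral>y. real_of_ereal (T (x + y)) \<partial>q)"

definition bass_map :: "real measure \<Rightarrow> real measure \<Rightarrow> real measure \<Rightarrow> real \<Rightarrow> ereal" where
  "bass_map q \<nu> \<alpha> = (\<lambda>x. quantile \<nu> (cdf (convolution \<alpha> q) x))"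

text \<open>The independent pair \<open>(X\<^sub>0, Y)\<close> with marginals \<open>\<alpha>\<close> and \<open>q\<close> is realised on the product space.
  Being defined on a set of full \<open>\<alpha>\<close>-measure means that \<open>T (X\<^sub>0 + Y)\<close> is almost surely finite and
  that \<open>q \<star> T\<close> is defined \<open>\<alpha>\<close>-almost everywhere.\<close>

definition represents_bass ::
  "real measure \<Rightarrow> real measure \<Rightarrow> real measure \<Rightarrow> (real \<times> real) measure \<Rightarrow> bool" where
  "represents_bass q \<nu> \<alpha> \<pi> \<longleftrightarrow>
     real_distribution \<alpha> \<and>
     (let T = bass_map q \<nu> \<alpha> in
        \<pi> = distr (\<alpha> \<Otimes>\<^sub>M q) (borel \<Otimes>\<^sub>M borel) (\<lambda>(x, y). (star q T x, real_of_ereal (T (x + y)))) \<and>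
        (\<exists>S \<in> sets borel. emeasure \<alpha> S = 1 \<and> (\<forall>x\<in>S. star_defined q T x) \<and>
            strict_mono_on S (star q T)))"

definition bass_martingale ::
  "real measure \<Rightarrow> real measure \<Rightarrow> real measure \<Rightarrow> (real \<times> real) measure \<Rightarrow> bool" where
  "bass_martingale q \<mu> \<nu> \<pi> \<longleftrightarrow> \<pi> \<in> martingale_couplings \<mu> \<nu> \<and> (\<exists>\<alpha>. represents_bass q \<nu> \<alpha> \<pi>)"

definition bass_measure :: "real measure \<Rightarrow> real measure \<Rightarrow> real measure \<Rightarrow> real measure \<Rightarrow> bool" where
  "bass_measure q \<mu> \<nu> \<alpha> \<longleftrightarrow> (\<exists>\<pi>. bass_martingale q \<mu> \<nu> \<pi> \<and> represents_bass q \<nu> \<alpha> \<pi>)"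

end

theory Submission
  imports Defs
begin

text \<open>Let \<open>\<alpha>\<close> and \<open>\<alpha>'\<close> be two Bass measures. The function \<open>q \<star> T\<close> carries \<open>\<alpha>\<close> to \<open>\<mu>\<close> and is injective on a set of
  full measure, so \<open>\<alpha>\<close> is the image of \<open>\<mu>\<close> under a strictly increasing map \<open>z\<close> of its atoms, and \<open>\<alpha>'\<close> likewise with a
  map \<open>z'\<close> (\<open>bass_measure_positions\<close>). Both Bass martingales then live on the space \<open>\<mu> \<Otimes>\<^sub>M q\<close> of pairs \<open>(x, y)\<close>: put
  \<open>W = z x + y\<close> and \<open>N = T W\<close>, and \<open>W' = z' x + y\<close> and \<open>N' = T' W'\<close>. Both \<open>N\<close> and \<open>N'\<close> have law \<open>\<nu>\<close> and conditional
  mean \<open>x\<close> given \<open>x\<close>.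

  The functional behind the problem is the maximal covariance of \<open>W\<close> with a variable of law \<open>\<nu>\<close>, a convex function of
  the positions \<open>z\<close>; Bass measures are critical points of it minus a linear function. Uniqueness of the critical
  point can be had directly. Since \<open>N\<close> is an increasing function of \<open>W\<close>, it is the optimal partner of \<open>W\<close>, so
  \<open>E (W (N - N')) \<ge> 0\<close>, and symmetrically \<open>E (W' (N' - N)) \<ge> 0\<close>. The sum is \<open>E ((z x - z' x) (N - N'))\<close>, which is zero as
  the conditional means agree. So both terms vanish, and because \<open>W\<close> has no atoms the optimal partner is unique
  (\<open>increasing_image_maximizes_covariance\<close>): \<open>N = N'\<close> almost surely (\<open>same_martingale\<close>).

  As \<open>\<nu>\<close> has no atoms, \<open>T\<close> determines the distribution function \<open>F\<close> of \<open>W\<close>, so \<open>F (z x + y) = F' (z' x + y)\<close> for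
  every atom \<open>x\<close> and every \<open>y\<close> in the support of \<open>q\<close> (\<open>same_distribution_function\<close>). For neighbouring atoms \<open>x < x'\<close>, if
  \<open>z x + supp q\<close> and \<open>z x' + supp q\<close> overlap in more than a point, this identity and the strict growth of \<open>F'\<close> on those
  intervals force \<open>z' - z\<close> to agree at \<open>x\<close> and \<open>x'\<close> (\<open>same_displacement_if_overlap\<close>). If they do not overlap, the
  martingale splits at a level between \<open>x\<close> and \<open>x'\<close>, against irreducibility (\<open>irreducible_imp_supports_overlap\<close>).
  So \<open>z' - z\<close> is constant.\<close>

section \<open>Increasing images as unique optimal partners\<close>

text \<open>The level set \<open>{N > t}\<close> of an increasing image of \<open>W\<close> is, up to a null set, an upper level set of \<open>W\<close>, with
some threshold \<open>s\<close>. Whenever the indicators of \<open>{N > t}\<close> and \<open>{N' > t}\<close> differ, the sign of their difference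
is therefore the sign of \<open>W - s\<close>. If the level set has probability 0 or 1 there may be no finite threshold;
then the two indicators agree almost surely, because \<open>N\<close> and \<open>N'\<close> have the same law, and any \<open>s\<close> will do.\<close>

lemma (in prob_space) increasing_image_threshold:
  fixes W N N' :: "'a \<Rightarrow> real" and T :: "real \<Rightarrow> real"
  assumes [measurable]: "random_variable borel W" "random_variable borel N" "random_variable borel N'"
    and T: "mono_on D T" "AE \<omega> in M. W \<omega> \<in> D \<and> N \<omega> = T (W \<omega>)"
    and law: "distr M borel N = distr M borel N'"
  obtains s where "AE \<omega> in M.
      0 \<le> (W \<omega> - s) * (indicator {t<..} (N \<omega>) - indicator {t<..} (N' \<omega>) :: real) \<and>
      ((W \<omega> - s) * (indicator {t<..} (N \<omega>) - indicator {t<..} (N' \<omega>) :: real) = 0 \<longrightarrow>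
        W \<omega> = s \<or> (indicator {t<..} (N \<omega>) :: real) = indicator {t<..} (N' \<omega>))"
proof -
  have same: "(AE \<omega> in M. P (N \<omega>)) \<longleftrightarrow> (AE \<omega> in M. P (N' \<omega>))" if [measurable]: "Measurable.pred borel P" for P
  proof -
    have "(AE \<omega> in M. P (N \<omega>)) \<longleftrightarrow> (AE x in distr M borel N. P x)"
      by (subst AE_distr_iff) auto
    also have "\<dots> \<longleftrightarrow> (AE \<omega> in M. P (N' \<omega>))"
      unfolding law by (subst AE_distr_iff) auto
    finally show ?thesis .
  qed
  consider "AE \<omega> in M. N \<omega> > t" | "AE \<omega> in M. \<not> N \<omega> > t"
    | "\<not> (AE \<omega> in M. N \<omega> > t)" "\<not> (AE \<omega> in M. \<not> N \<omega> > t)" by blast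
  then show ?thesis
  proof cases
    case 1
    then have "AE \<omega> in M. N' \<omega> > t" using same[of "\<lambda>n. n > t"] by simp
    with 1 have "AE \<omega> in M. N \<omega> > t \<and> N' \<omega> > t" by auto
    then have "AE \<omega> in M.
      0 \<le> (W \<omega> - 0) * (indicator {t<..} (N \<omega>) - indicator {t<..} (N' \<omega>) :: real) \<and>
      ((W \<omega> - 0) * (indicator {t<..} (N \<omega>) - indicator {t<..} (N' \<omega>) :: real) = 0 \<longrightarrow>
        W \<omega> = 0 \<or> (indicator {t<..} (N \<omega>) :: real) = indicator {t<..} (N' \<omega>))"
      by eventually_elim (simp add: indicator_def)
    then show ?thesis by (rule that[of 0])
  next
    case 2
    then have "AE \<omega> in M. \<not> N' \<omega> > t" using same[of "\<lambda>n. \<not> n > t"] by simp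
    with 2 have "AE \<omega> in M. \<not> N \<omega> > t \<and> \<not> N' \<omega> > t" by auto
    then have "AE \<omega> in M.
      0 \<le> (W \<omega> - 0) * (indicator {t<..} (N \<omega>) - indicator {t<..} (N' \<omega>) :: real) \<and>
      ((W \<omega> - 0) * (indicator {t<..} (N \<omega>) - indicator {t<..} (N' \<omega>) :: real) = 0 \<longrightarrow>
        W \<omega> = 0 \<or> (indicator {t<..} (N \<omega>) :: real) = indicator {t<..} (N' \<omega>))"
      by eventually_elim (simp add: indicator_def)
    then show ?thesis by (rule that[of 0])
  next
    case 3
    define L where "L = {w \<in> D. T w > t}"
    have "\<exists>\<omega>. W \<omega> \<in> D \<and> N \<omega> = T (W \<omega>) \<and> \<not> N \<omega> > t"
    proof (rule ccontr)
      assume "\<nexists>\<omega>. W \<omega> \<in> D \<and> N \<omega> = T (W \<omega>) \<and> \<not> N \<omega> > t"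
      then have none: "\<forall>\<omega>. \<not> (W \<omega> \<in> D \<and> N \<omega> = T (W \<omega>) \<and> \<not> N \<omega> > t)" by simp
      have "AE \<omega> in M. N \<omega> > t"
        using T(2)
      proof eventually_elim
        case (elim \<omega>)
        then show ?case using none[THEN spec, of \<omega>] by simp
      qed
      then show False using 3(1) by blast
    qed
    then obtain \<omega>1 where 1: "W \<omega>1 \<in> D" "\<not> T (W \<omega>1) > t" by auto
    have "\<exists>\<omega>. W \<omega> \<in> D \<and> N \<omega> = T (W \<omega>) \<and> N \<omega> > t"
    proof (rule ccontr)
      assume "\<nexists>\<omega>. W \<omega> \<in> D \<and> N \<omega> = T (W \<omega>) \<and> N \<omega> > t"
      then have none: "\<forall>\<omega>. \<not> (W \<omega> \<in> D \<and> N \<omega> = T (W \<omega>) \<and> N \<omega> > t)" by simp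
      have "AE \<omega> in M. \<not> N \<omega> > t"
        using T(2)
      proof eventually_elim
        case (elim \<omega>)
        then show ?case using none[THEN spec, of \<omega>] by simp
      qed
      then show False using 3(2) by blast
    qed
    then obtain \<omega>2 where 2: "W \<omega>2 \<in> D" "T (W \<omega>2) > t" by auto
    have lower: "w \<le> v" if "w \<in> D" "\<not> T w > t" "v \<in> L" for w v
    proof (rule ccontr)
      assume "\<not> w \<le> v"
      then have "T v \<le> T w" using that mono_onD[OF T(1), of v w] by (simp add: L_def)
      then show False using that by (simp add: L_def)
    qed
    have bdd: "bdd_below L" using lower[OF 1] by (rule bdd_belowI)
    have ne: "L \<noteq> {}" using 2 by (auto simp: L_def)
    have "AE \<omega> in M. (N \<omega> > t \<longrightarrow> Inf L \<le> W \<omega>) \<and> (\<not> N \<omega> > t \<longrightarrow> W \<omega> \<le> Inf L)"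
      using T(2)
    proof eventually_elim
      case (elim \<omega>)
      then show ?case
        using lower[of "W \<omega>"] cInf_lower[OF _ bdd, of "W \<omega>"] cInf_greatest[OF ne, of "W \<omega>"]
        by (cases "t < T (W \<omega>)") (simp_all add: L_def)
    qed
    then have "AE \<omega> in M.
      0 \<le> (W \<omega> - Inf L) * (indicator {t<..} (N \<omega>) - indicator {t<..} (N' \<omega>) :: real) \<and>
      ((W \<omega> - Inf L) * (indicator {t<..} (N \<omega>) - indicator {t<..} (N' \<omega>) :: real) = 0 \<longrightarrow>
        W \<omega> = Inf L \<or> (indicator {t<..} (N \<omega>) :: real) = indicator {t<..} (N' \<omega>))"
    proof eventually_elim
      case (elim \<omega>)
      then show ?case
        by (cases "N \<omega> > t"; cases "N' \<omega> > t") auto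
    qed
    then show ?thesis by (rule that[of "Inf L"])
  qed
qed

text \<open>The layer cake formula for a difference. Passing to the difference makes the integrand integrable over the
whole line, which spares a separate treatment of positive and negative parts.\<close>

lemma integral_level_sets_diff:
  fixes n n' :: real
  shows "integrable lborel (\<lambda>t. indicator {t<..} n - indicator {t<..} n' :: real)"
    and "(\<integral>t. (indicator {t<..} n - indicator {t<..} n') \<partial>lborel) = n - n'"
    and "(\<integral>t. \<bar>indicator {t<..} n - indicator {t<..} n'\<bar> \<partial>lborel) = \<bar>n - n'\<bar>"
proof -
  have *: "(\<lambda>t. indicator {t<..} n - indicator {t<..} n' :: real) =
      (\<lambda>t. indicator {n'..<n} t - indicator {n..<n'} t)" by (auto simp: fun_eq_iff indicator_def)
  have **: "(\<lambda>t. \<bar>indicator {t<..} n - indicator {t<..} n' :: real\<bar>) =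
      (\<lambda>t. indicator {n'..<n} t + indicator {n..<n'} t)" by (auto simp: fun_eq_iff indicator_def)
  have i: "integrable lborel (\<lambda>t::real. indicator {u..<v} t :: real)" for u v
    by (cases "u \<le> v") (auto simp: integrable_indicator_iff)
  show "integrable lborel (\<lambda>t. indicator {t<..} n - indicator {t<..} n' :: real)"
    unfolding * by (intro Bochner_Integration.integrable_diff i)
  show "(\<integral>t. (indicator {t<..} n - indicator {t<..} n') \<partial>lborel) = n - n'"
    unfolding * by (cases "n \<le> n'") (auto simp: i)
  show "(\<integral>t. \<bar>indicator {t<..} n - indicator {t<..} n'\<bar> \<partial>lborel) = \<bar>n - n'\<bar>"
    unfolding ** by (cases "n \<le> n'") (auto simp: i)
qed

text \<open>Among all random variables with the law of \<open>N\<close>, an increasing image of \<open>W\<close> has the largest covariance with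
\<open>W\<close>, and it is the only maximizer if \<open>W\<close> has no atoms. Slice \<open>N - N'\<close> into level sets: its product with \<open>W\<close>
has expectation equal to the integral over \<open>t\<close> of the expectation of \<open>W\<close> times the difference of the
indicators of \<open>{N > t}\<close> and \<open>{N' > t}\<close>. That difference has mean zero, so \<open>W\<close> may be replaced by \<open>W - s\<close> with the
threshold \<open>s\<close> of the level \<open>t\<close>, and then the integrand is nonnegative. If the total vanishes, the indicators
agree for almost every level.\<close>

lemma (in prob_space) increasing_image_maximizes_covariance:
  fixes W N N' :: "'a \<Rightarrow> real" and T :: "real \<Rightarrow> real"
  assumes [measurable]: "random_variable borel W" "random_variable borel N" "random_variable borel N'"
    and T: "mono_on D T" "AE \<omega> in M. W \<omega> \<in> D \<and> N \<omega> = T (W \<omega>)"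
    and law: "distr M borel N = distr M borel N'"
    and int: "integrable M (\<lambda>\<omega>. W \<omega> * (N \<omega> - N' \<omega>))"
  shows "0 \<le> (\<integral>\<omega>. W \<omega> * (N \<omega> - N' \<omega>) \<partial>M)"
    and "(\<And>s. AE \<omega> in M. W \<omega> \<noteq> s) \<Longrightarrow> (\<integral>\<omega>. W \<omega> * (N \<omega> - N' \<omega>) \<partial>M) = 0 \<Longrightarrow> AE \<omega> in M. N \<omega> = N' \<omega>"
proof -
  interpret P: pair_sigma_finite M lborel ..
  define g :: "'a \<Rightarrow> real \<Rightarrow> real" where "g \<omega> t = indicator {t<..} (N \<omega>) - indicator {t<..} (N' \<omega>)" for \<omega> t
  have g_alt: "g = (\<lambda>\<omega> t. (if t < N \<omega> then 1 else 0) - (if t < N' \<omega> then 1 else 0))"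
    by (auto simp: g_def fun_eq_iff indicator_def)
  have [measurable]: "(\<lambda>(\<omega>, t). g \<omega> t) \<in> borel_measurable (M \<Otimes>\<^sub>M lborel)"
    unfolding g_alt by measurable
  have [measurable]: "(\<lambda>\<omega>. g \<omega> t) \<in> borel_measurable M" for t
    unfolding g_alt by measurable
  have g_le: "\<bar>g \<omega> t\<bar> \<le> 1" for \<omega> t by (auto simp: g_def indicator_def)
  have g_int: "integrable M (\<lambda>\<omega>. g \<omega> t)" for t
    by (rule integrable_const_bound[of _ 1]) (use g_le in auto)
  have g_zero: "(\<integral>\<omega>. g \<omega> t \<partial>M) = 0" for t
  proof -
    have "(\<integral>\<omega>. indicator {t<..} (N \<omega>) \<partial>M) = (\<integral>\<omega>. indicator {t<..} (N' \<omega>) \<partial>M :: real)"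
      using integral_distr[of N M borel "indicator {t<..} :: real \<Rightarrow> real"]
        integral_distr[of N' M borel "indicator {t<..} :: real \<Rightarrow> real"] law by simp
    moreover have "integrable M (\<lambda>\<omega>. indicator {t<..} (X \<omega>) :: real)"
      if [measurable]: "random_variable borel X" for X
      by (rule integrable_const_bound[of _ 1]) (auto simp: indicator_def)
    ultimately show ?thesis unfolding g_def by simp
  qed
  have h_int: "integrable (M \<Otimes>\<^sub>M lborel) (\<lambda>(\<omega>, t). W \<omega> * g \<omega> t)"
  proof (rule P.Fubini_integrable)
    have "(\<integral>t. norm (W \<omega> * g \<omega> t) \<partial>lborel) = norm (W \<omega> * (N \<omega> - N' \<omega>))" for \<omega>
      by (simp add: abs_mult g_def integral_level_sets_diff)
    then show "integrable M (\<lambda>\<omega>. \<integral>t. norm (case (\<omega>, t) of (\<omega>, t) \<Rightarrow> W \<omega> * g \<omega> t) \<partial>lborel)"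
      using int by (simp only: prod.case) (rule integrable_norm)
    show "AE \<omega> in M. integrable lborel (\<lambda>t. case (\<omega>, t) of (\<omega>, t) \<Rightarrow> W \<omega> * g \<omega> t)"
      by (simp add: g_def integral_level_sets_diff)
  qed measurable
  define \<psi> where "\<psi> t = (\<integral>\<omega>. W \<omega> * g \<omega> t \<partial>M)" for t
  have total: "(\<integral>\<omega>. W \<omega> * (N \<omega> - N' \<omega>) \<partial>M) = (\<integral>t. \<psi> t \<partial>lborel)"
  proof -
    have "(\<integral>t. \<psi> t \<partial>lborel) = (\<integral>\<omega>. (\<integral>t. W \<omega> * g \<omega> t \<partial>lborel) \<partial>M)"
      unfolding \<psi>_def using P.Fubini_integral[OF h_int] .
    then show ?thesis by (simp add: g_def integral_level_sets_diff)
  qed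
  have \<psi>_int: "integrable lborel \<psi>"
    unfolding \<psi>_def using P.integrable_snd[OF h_int] .
  have slice: "AE t in lborel. integrable M (\<lambda>\<omega>. W \<omega> * g \<omega> t)"
    using P.AE_integrable_snd[OF h_int] .
  \<comment> \<open>The mean-zero difference of indicators allows the level-dependent shift of \<open>W\<close> by the threshold.\<close>
  have shift: "\<exists>s. integrable M (\<lambda>\<omega>. (W \<omega> - s) * g \<omega> t) \<and> \<psi> t = (\<integral>\<omega>. (W \<omega> - s) * g \<omega> t \<partial>M) \<and>
      (AE \<omega> in M. 0 \<le> (W \<omega> - s) * g \<omega> t \<and> ((W \<omega> - s) * g \<omega> t = 0 \<longrightarrow> W \<omega> = s \<or> g \<omega> t = 0))"
    if *: "integrable M (\<lambda>\<omega>. W \<omega> * g \<omega> t)" for t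
  proof -
    obtain s where "AE \<omega> in M. 0 \<le> (W \<omega> - s) * g \<omega> t \<and>
        ((W \<omega> - s) * g \<omega> t = 0 \<longrightarrow>
          W \<omega> = s \<or> (indicator {t<..} (N \<omega>) :: real) = indicator {t<..} (N' \<omega>))"
      by (rule increasing_image_threshold[OF assms(1-3) T law, of t, folded g_def])
    then have s: "AE \<omega> in M. 0 \<le> (W \<omega> - s) * g \<omega> t \<and>
        ((W \<omega> - s) * g \<omega> t = 0 \<longrightarrow> W \<omega> = s \<or> g \<omega> t = 0)"
      by (simp add: g_def)
    have "integrable M (\<lambda>\<omega>. (W \<omega> - s) * g \<omega> t)"
      using * g_int[of t] by (simp add: left_diff_distrib)
    moreover have "\<psi> t = (\<integral>\<omega>. (W \<omega> - s) * g \<omega> t \<partial>M)"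
      using * g_int[of t] g_zero[of t] by (simp add: left_diff_distrib \<psi>_def)
    ultimately show ?thesis using s by auto
  qed
  have \<psi>_nonneg: "AE t in lborel. 0 \<le> \<psi> t"
    using slice
  proof eventually_elim
    case (elim t)
    obtain s where s: "\<psi> t = (\<integral>\<omega>. (W \<omega> - s) * g \<omega> t \<partial>M)" "AE \<omega> in M. 0 \<le> (W \<omega> - s) * g \<omega> t"
      using shift[OF elim] by auto
    then show ?case by (simp add: integral_nonneg_AE)
  qed
  show "0 \<le> (\<integral>\<omega>. W \<omega> * (N \<omega> - N' \<omega>) \<partial>M)"
    unfolding total using \<psi>_nonneg by (rule integral_nonneg_AE)
  assume noatom: "\<And>s. AE \<omega> in M. W \<omega> \<noteq> s" and zero: "(\<integral>\<omega>. W \<omega> * (N \<omega> - N' \<omega>) \<partial>M) = 0"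
  have "AE t in lborel. \<psi> t = 0"
    using integral_nonneg_eq_0_iff_AE[OF \<psi>_int \<psi>_nonneg] zero total by simp
  with slice have "AE t in lborel. AE \<omega> in M. g \<omega> t = 0"
  proof eventually_elim
    case (elim t)
    obtain s where s: "integrable M (\<lambda>\<omega>. (W \<omega> - s) * g \<omega> t)" "\<psi> t = (\<integral>\<omega>. (W \<omega> - s) * g \<omega> t \<partial>M)"
      "AE \<omega> in M. 0 \<le> (W \<omega> - s) * g \<omega> t"
      "AE \<omega> in M. (W \<omega> - s) * g \<omega> t = 0 \<longrightarrow> W \<omega> = s \<or> g \<omega> t = 0"
      using shift[OF elim(1)] by auto
    have "AE \<omega> in M. (W \<omega> - s) * g \<omega> t = 0"
      using integral_nonneg_eq_0_iff_AE[OF s(1,3)] s(2) elim(2) by simp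
    then show ?case using s(4) noatom[of s] by eventually_elim auto
  qed
  moreover have "{x \<in> space (M \<Otimes>\<^sub>M lborel). (\<lambda>(\<omega>, t). g \<omega> t) x = 0} \<in> sets (M \<Otimes>\<^sub>M lborel)"
    by measurable
  ultimately have "AE \<omega> in M. AE t in lborel. g \<omega> t = 0"
    using P.AE_commute[of "\<lambda>\<omega> t. g \<omega> t = 0"] by (simp add: case_prod_beta')
  then show "AE \<omega> in M. N \<omega> = N' \<omega>"
  proof eventually_elim
    case (elim \<omega>)
    have "N \<omega> - N' \<omega> = (\<integral>t. g \<omega> t \<partial>lborel)" by (simp add: g_def integral_level_sets_diff)
    also have "\<dots> = 0" using elim by (rule integral_eq_zero_AE)
    finally show ?case by simp
  qed
qed

text \<open>Young's inequality with the conjugate exponents \<open>a\<close> and \<open>a / (a - 1)\<close>; the larger exponent \<open>b\<close> only costs the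
constant 1.\<close>

lemma integrable_mult_of_powr:
  fixes f g :: "'a \<Rightarrow> real"
  assumes [measurable]: "f \<in> borel_measurable M" "g \<in> borel_measurable M"
    and fin: "finite_measure M"
    and ab: "a > 1" "b \<ge> a / (a - 1)"
    and int: "integrable M (\<lambda>x. \<bar>f x\<bar> powr a)" "integrable M (\<lambda>x. \<bar>g x\<bar> powr b)"
  shows "integrable M (\<lambda>x. g x * f x)"
proof (rule Bochner_Integration.integrable_bound[where f = "\<lambda>x. \<bar>f x\<bar> powr a + (1 + \<bar>g x\<bar> powr b)"])
  interpret finite_measure M by fact
  show "integrable M (\<lambda>x. \<bar>f x\<bar> powr a + (1 + \<bar>g x\<bar> powr b))"
    using int by simp
  define p where "p = a / (a - 1)"
  have p: "p > 1" "1 / p + 1 / a = 1" using ab by (auto simp: p_def field_simps)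
  have "\<bar>v\<bar> * \<bar>u\<bar> \<le> \<bar>u\<bar> powr a + (1 + \<bar>v\<bar> powr b)" for u v :: real
  proof -
    have "\<bar>v\<bar> * \<bar>u\<bar> \<le> \<bar>v\<bar> powr p / p + \<bar>u\<bar> powr a / a"
      by (rule Youngs_inequality) (use p ab in auto)
    also have "\<dots> \<le> \<bar>v\<bar> powr p + \<bar>u\<bar> powr a"
    proof (intro add_mono)
      have shrink: "x / r \<le> x" if "0 \<le> x" "1 < r" for x r :: real
        using that mult_left_mono[of 1 r x] by (simp add: field_simps)
      show "\<bar>v\<bar> powr p / p \<le> \<bar>v\<bar> powr p" "\<bar>u\<bar> powr a / a \<le> \<bar>u\<bar> powr a"
        using p(1) ab(1) by (auto intro: shrink)
    qed
    also have "\<bar>v\<bar> powr p \<le> 1 + \<bar>v\<bar> powr b"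
    proof (cases "\<bar>v\<bar> \<le> 1")
      case True
      then have "\<bar>v\<bar> powr p \<le> 1" using p(1) by (simp add: powr_le1)
      then show ?thesis by (simp add: add_increasing2)
    next
      case False
      then have "\<bar>v\<bar> powr p \<le> \<bar>v\<bar> powr b" using ab by (intro powr_mono) (auto simp: p_def)
      then show ?thesis by simp
    qed
    finally show ?thesis by simp
  qed
  then show "AE x in M. norm (g x * f x) \<le> norm (\<bar>f x\<bar> powr a + (1 + \<bar>g x\<bar> powr b))"
    by (auto simp: abs_mult intro!: order_trans[OF _ abs_ge_self])
qed measurable

section \<open>Distribution functions, quantiles and supports\<close>

text \<open>By continuity, the set where the distribution function vanishes is empty or a closed half-line ending at a
point \<open>s\<close> where it still vanishes, so its measure is \<open>F s = 0\<close>. Likewise the set where it equals 1 is empty or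
a closed half-line, and of the latter only the end point could carry mass.\<close>

lemma (in real_distribution) AE_cdf_strictly_between:
  assumes atomless: "\<And>w. measure M {w} = 0"
  shows "AE w in M. 0 < cdf M w \<and> cdf M w < 1"
proof -
  have cont: "continuous_on UNIV (cdf M)"
    using isCont_cdf atomless by (simp add: continuous_at_imp_continuous_on)
  have "AE w in M. cdf M w \<noteq> 0"
  proof (cases "{w. cdf M w = 0} = {}")
    case False
    have "\<exists>b. cdf M b > 0"
      by (rule eventually_happens'[OF trivial_limit_at_top_linorder order_tendstoD(1)[OF cdf_lim_at_top_prob, of 0]]) simp
    then obtain b where b: "cdf M b > 0" ..
    have bdd: "bdd_above {w. cdf M w = 0}"
    proof (rule bdd_aboveI)
      show "w \<le> b" if "w \<in> {w. cdf M w = 0}" for w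
        using that b cdf_nondecreasing[of b w] by (cases "w \<le> b") auto
    qed
    define s where "s = Sup {w. cdf M w = 0}"
    have "closed {w. cdf M w = 0}"
      using cont by (intro closed_Collect_eq) auto
    then have s: "cdf M s = 0"
      using closed_contains_Sup[OF False bdd] by (simp add: s_def)
    have "{..s} \<in> null_sets M"
      using s by (auto simp: cdf_def null_sets_def emeasure_eq_measure)
    moreover have "{w \<in> space M. \<not> cdf M w \<noteq> 0} \<subseteq> {..s}"
      using cSup_upper[OF _ bdd] by (auto simp: s_def)
    ultimately show ?thesis by (rule AE_I')
  qed auto
  moreover have "AE w in M. cdf M w \<noteq> 1"
  proof (cases "{w. cdf M w = 1} = {}")
    case False
    have "\<exists>b. cdf M b < 1"
      by (rule eventually_happens'[OF trivial_limit_at_bot_linorder order_tendstoD(2)[OF cdf_lim_at_bot, of 1]]) simp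
    then obtain b where b: "cdf M b < 1" ..
    have bdd: "bdd_below {w. cdf M w = 1}"
    proof (rule bdd_belowI)
      show "b \<le> w" if "w \<in> {w. cdf M w = 1}" for w
        using that b cdf_nondecreasing[of w b] by (cases "b \<le> w") auto
    qed
    define s where "s = Inf {w. cdf M w = 1}"
    have "closed {w. cdf M w = 1}"
      using cont by (intro closed_Collect_eq) auto
    then have s: "cdf M s = 1"
      using closed_contains_Inf[OF False bdd] by (simp add: s_def)
    have "AE w in M. w \<in> {..s}"
      using s by (intro AE_prob_1) (simp add: cdf_def)
    moreover have "AE w in M. w \<noteq> s"
      using atomless[of s] by (intro AE_I'[of "{s}"]) (auto simp: null_sets_def emeasure_eq_measure)
    ultimately show ?thesis
    proof eventually_elim
      case (elim w)
      then show ?case using cInf_lower[OF _ bdd, of w] by (force simp: s_def)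
    qed
  qed auto
  ultimately show ?thesis
  proof eventually_elim
    case (elim w)
    then show ?case using cdf_nonneg[of w] cdf_bounded_prob[of w] by linarith
  qed
qed

lemma (in real_distribution) cdf_quantile:
  assumes atomless: "\<And>w. measure M {w} = 0" and u: "0 < u" "u < 1"
  shows "cdf M (Inf {y. u \<le> cdf M y}) = u"
proof (rule antisym)
  interpret cdf_distribution M by unfold_locales
  let ?y = "Inf {y. u \<le> cdf M y}"
  show "u \<le> cdf M ?y" using pseudoinverse[OF u, of ?y] by simp
  have less: "cdf M y \<le> u" if "y < ?y" for y
    using pseudoinverse[OF u, of y] that by linarith
  have "(cdf M \<longlongrightarrow> cdf M ?y) (at_left ?y)"
    using isCont_cdf[of ?y] atomless[of ?y] by (simp add: isCont_def filterlim_at_split)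
  moreover have "\<forall>\<^sub>F y in at_left ?y. cdf M y \<le> u"
    unfolding eventually_at_filter by (rule always_eventually) (use less in auto)
  ultimately show "cdf M ?y \<le> u"
    by (rule tendsto_upperbound) (simp add: trivial_limit_at_left_real)
qed

lemma borel_measurable_quantile:
  assumes "real_distribution \<nu>"
  shows "(\<lambda>u. real_of_ereal (quantile \<nu> u)) \<in> borel_measurable borel"
proof -
  interpret cdf_distribution \<nu> by (simp add: cdf_distribution_def assms)
  have [measurable]: "(\<lambda>u. indicator {0<..<1} u *\<^sub>R I u) \<in> borel_measurable borel"
    using measurable_CI by (subst (asm) borel_measurable_restrict_space_iff) auto
  have "(\<lambda>u. real_of_ereal (quantile \<nu> u)) =
     (\<lambda>u. if u \<le> 0 then real_of_ereal (Inf (ereal ` supp \<nu>))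
          else if 1 \<le> u then real_of_ereal (Sup (ereal ` supp \<nu>))
          else indicator {0<..<1} u *\<^sub>R I u)"
    by (auto simp: fun_eq_iff quantile_def)
  also have "\<dots> \<in> borel_measurable borel" by measurable
  finally show ?thesis .
qed

text \<open>The law \<open>\<pi>\<close> of a Bass martingale is a push-forward along a map built from \<open>T\<close>, so its marginals can be
computed only once \<open>T\<close> is known to be measurable.\<close>

lemma borel_measurable_bass_map:
  assumes "real_distribution \<nu>" "real_distribution \<alpha>" "real_distribution q"
  shows "(\<lambda>w. real_of_ereal (bass_map q \<nu> \<alpha> w)) \<in> borel_measurable borel"
proof -
  interpret A: real_distribution \<alpha> by fact
  interpret Q: real_distribution q by fact
  interpret P: pair_prob_space \<alpha> q ..
  have "real_distribution (convolution \<alpha> q)"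
    unfolding convolution_def by (intro P.real_distribution_distr) measurable
  then interpret R: cdf_distribution "convolution \<alpha> q" by (simp add: cdf_distribution_def)
  show ?thesis
    unfolding bass_map_def
    by (rule measurable_compose[OF R.measurable_C borel_measurable_quantile[OF assms(1)]])
qed

lemma (in finite_measure) AE_at_atom:
  assumes "AE x in M. P x" "0 < measure M {x}"
  shows "P x"
proof (rule ccontr)
  assume not: "\<not> P x"
  obtain N where N: "{x \<in> space M. \<not> P x} \<subseteq> N" "emeasure M N = 0" "N \<in> sets M"
    using AE_E[OF assms(1)] by blast
  have "{x} \<in> sets M" using assms(2) measure_notin_sets by force
  then have "x \<in> N" using N(1) not sets.sets_into_space by blast
  then have "measure M {x} \<le> measure M N" using N(3) by (intro finite_measure_mono) auto
  then show False using N(2) assms(2) by (simp add: measure_def)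
qed

text \<open>The complement of the support is covered by countably many basic open null sets.\<close>

lemma AE_in_supp:
  fixes \<xi> :: "real measure"
  assumes [measurable_cong]: "sets \<xi> = sets borel"
  shows "AE x in \<xi>. x \<in> supp \<xi>"
proof -
  obtain B :: "real set set" where B: "countable B" "topological_basis B"
    using ex_countable_basis by blast
  have "AE x in \<xi>. \<forall>U\<in>{U\<in>B. emeasure \<xi> U = 0}. x \<notin> U"
  proof (subst AE_ball_countable)
    show "countable {U \<in> B. emeasure \<xi> U = 0}" using B(1) by auto
    show "\<forall>U\<in>{U \<in> B. emeasure \<xi> U = 0}. AE x in \<xi>. x \<notin> U"
    proof
      fix U assume U: "U \<in> {U \<in> B. emeasure \<xi> U = 0}"
      then have "open U" using B(2) topological_basis_open by blast
      then have "U \<in> null_sets \<xi>" using U assms by (auto simp: null_sets_def)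
      then show "AE x in \<xi>. x \<notin> U" by (rule AE_not_in)
    qed
  qed
  then show ?thesis
  proof eventually_elim
    case (elim x)
    show ?case unfolding supp_def
    proof (intro CollectI allI impI)
      fix U assume U: "open U" "x \<in> U"
      then obtain V where V: "V \<in> B" "x \<in> V" "V \<subseteq> U" using topological_basisE[OF B(2)] by metis
      have "U \<in> sets \<xi>" using U assms by simp
      then have "emeasure \<xi> V \<le> emeasure \<xi> U" using V by (intro emeasure_mono) auto
      moreover have "emeasure \<xi> V \<noteq> 0" using elim V by auto
      ultimately show "emeasure \<xi> U > 0" by (metis not_gr_zero le_zero_eq)
    qed
  qed
qed

lemma AE_eq_imp_eq_on_supp:
  fixes f g :: "real \<Rightarrow> real"
  assumes "sets \<xi> = sets borel" and cont: "continuous_on UNIV f" "continuous_on UNIV g"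
    and ae: "AE x in \<xi>. f x = g x" and x: "x \<in> supp \<xi>"
  shows "f x = g x"
proof (rule ccontr)
  assume "f x \<noteq> g x"
  moreover have U: "open {x. f x \<noteq> g x}" using cont by (intro open_Collect_neq)
  ultimately have "emeasure \<xi> {x. f x \<noteq> g x} > 0" using x by (auto simp: supp_def)
  moreover have "emeasure \<xi> {x. f x \<noteq> g x} = 0"
    using ae U assms(1) sets_eq_imp_space_eq[OF assms(1)] by (subst (asm) AE_iff_measurable[OF _ refl]) auto
  ultimately show False by simp
qed

lemma absolutely_continuous_imp_atomless:
  fixes x :: real
  assumes "absolutely_continuous lborel M"
  shows "measure M {x} = 0"
proof -
  have "{x} \<in> null_sets lborel" by (simp add: null_sets_def)
  then have "{x} \<in> null_sets M" using assms unfolding absolutely_continuous_def by blast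
  then show ?thesis by (simp add: null_sets_def measure_def)
qed

lemma (in prob_space) finite_support_atoms:
  assumes A: "finite A" "emeasure M A = 1" and singletons: "\<And>x. {x} \<in> sets M"
  shows "finite {x. 0 < measure M {x}}" "AE x in M. 0 < measure M {x}"
proof -
  have "A \<in> sets M"
  proof (rule ccontr)
    assume "A \<notin> sets M"
    then show False using A(2) emeasure_notin_sets[of A M] by simp
  qed
  then have AE_A: "AE x in M. x \<in> A"
    using A(2) by (intro AE_prob_1) (simp add: emeasure_eq_measure)
  have "{x. 0 < measure M {x}} \<subseteq> A" using AE_at_atom[OF AE_A] by blast
  then show "finite {x. 0 < measure M {x}}" using A(1) finite_subset by blast
  have "AE x in M. \<forall>w\<in>{w\<in>A. measure M {w} = 0}. x \<noteq> w"
  proof (subst AE_finite_all)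
    show "finite {w\<in>A. measure M {w} = 0}" using A(1) by simp
    show "\<forall>w\<in>{w\<in>A. measure M {w} = 0}. AE x in M. x \<noteq> w"
    proof
      fix w assume "w \<in> {w\<in>A. measure M {w} = 0}"
      then have "{w} \<in> null_sets M" using singletons by (auto simp: null_sets_def emeasure_eq_measure)
      then show "AE x in M. x \<noteq> w" using AE_not_in by fastforce
    qed
  qed
  with AE_A show "AE x in M. 0 < measure M {x}"
    by eventually_elim (auto simp: zero_less_measure_iff measure_def[symmetric] order.strict_iff_order)
qed

section \<open>Bass martingales with an atomic initial law\<close>

text \<open>The part of the hypotheses that concerns the data alone. The first marginal is purely atomic, so an assertion
about \<open>\<mu>\<close>-almost every \<open>x\<close> is one about every atom.\<close>

locale bass_problem = X: real_distribution \<mu> + NU: real_distribution \<nu> + Q: real_distribution q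
  for \<mu> \<nu> q :: "real measure" +
  fixes a b :: real
  assumes atomic: "AE x in \<mu>. 0 < measure \<mu> {x}"
    and atomless_target: "measure \<nu> {y} = 0"
    and atomless_noise: "measure q {y} = 0"
    and exponents: "a > 1" "b \<ge> a / (a - 1)"
    and integrable_target: "integrable \<nu> (\<lambda>y. y)"
    and moments: "integrable \<nu> (\<lambda>y. \<bar>y\<bar> powr a)" "integrable q (\<lambda>y. \<bar>y\<bar> powr b)"
begin

sublocale P: pair_prob_space \<mu> q ..

lemma prob_noise_UNIV: "measure q UNIV = 1"
  using Q.prob_space by simp

lemma sets_pair [measurable_cong]: "sets (\<mu> \<Otimes>\<^sub>M q) = sets (borel \<Otimes>\<^sub>M borel)"
  by (intro sets_pair_measure_cong) auto

lemma AE_pair_at_atom: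
  assumes "AE \<omega> in \<mu> \<Otimes>\<^sub>M q. R \<omega>" "0 < measure \<mu> {x}"
  shows "AE y in q. R (x, y)"
  using X.AE_at_atom[OF P.AE_pair[OF assms(1)] assms(2)] .

end

text \<open>A Bass measure is the image of \<open>\<mu>\<close> under a map \<open>z\<close> that sends each atom \<open>x\<close> to the starting point of the
underlying process that yields \<open>M\<^sub>0 = x\<close>. Hence all Bass measures are realized on the one probability
space \<open>\<mu> \<Otimes>\<^sub>M q\<close>, with the same initial value \<open>fst\<close> and the same noise \<open>snd\<close>, and can be compared there.\<close>

locale bass_solution = bass_problem \<mu> \<nu> q a b for \<mu> \<nu> q a b +
  fixes z :: "real \<Rightarrow> real"
  assumes position_measurable [measurable]: "z \<in> borel_measurable borel"
    and position_bounded: "bounded (range z)"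
    and position_strict_mono: "strict_mono_on {x. 0 < measure \<mu> {x}} z"
    and target_law: "distr (\<mu> \<Otimes>\<^sub>M q) borel
        (\<lambda>(x, y). real_of_ereal (bass_map q \<nu> (distr \<mu> borel z) (z x + y))) = \<nu>"
    and star_defined_atom: "0 < measure \<mu> {x} \<Longrightarrow> star_defined q (bass_map q \<nu> (distr \<mu> borel z)) (z x)"
    and star_atom: "0 < measure \<mu> {x} \<Longrightarrow> star q (bass_map q \<nu> (distr \<mu> borel z)) (z x) = x"
begin

text \<open>The underlying process starts in \<open>z x\<close> and ends in \<open>W = z x + y\<close>; the Bass martingale starts in \<open>x\<close> and
ends in \<open>N = T W\<close>.\<close>

definition T :: "real \<Rightarrow> real" where
  "T w = real_of_ereal (bass_map q \<nu> (distr \<mu> borel z) w)"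

definition F :: "real \<Rightarrow> real" where
  "F = cdf (convolution (distr \<mu> borel z) q)"

definition W :: "real \<times> real \<Rightarrow> real" where
  "W \<omega> = z (fst \<omega>) + snd \<omega>"

definition N :: "real \<times> real \<Rightarrow> real" where
  "N \<omega> = T (W \<omega>)"

lemma T_measurable [measurable]: "T \<in> borel_measurable borel"
  unfolding T_def
  by (intro borel_measurable_bass_map NU.real_distribution_axioms Q.real_distribution_axioms
      X.real_distribution_distr) measurable

lemma W_measurable [measurable]: "W \<in> borel_measurable (\<mu> \<Otimes>\<^sub>M q)"
  unfolding W_def by measurable

lemma N_measurable [measurable]: "N \<in> borel_measurable (\<mu> \<Otimes>\<^sub>M q)"
  unfolding N_def by measurable

lemma law_W: "distr (\<mu> \<Otimes>\<^sub>M q) borel W = convolution (distr \<mu> borel z) q"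
proof -
  have q: "distr q borel (\<lambda>y. y) = q" by (rule distr_id2) simp
  have "distr \<mu> borel z \<Otimes>\<^sub>M q = distr (\<mu> \<Otimes>\<^sub>M q) (borel \<Otimes>\<^sub>M borel) (\<lambda>(x, y). (z x, y))"
    by (rule pair_measure_distr[of z \<mu> borel "\<lambda>y. y" q borel, unfolded q, OF _ _ Q.sigma_finite_measure_axioms])
      measurable
  then have "convolution (distr \<mu> borel z) q =
      distr (distr (\<mu> \<Otimes>\<^sub>M q) (borel \<Otimes>\<^sub>M borel) (\<lambda>(x, y). (z x, y))) borel (\<lambda>(x, y). x + y)"
    by (simp only: convolution_def)
  also have "\<dots> = distr (\<mu> \<Otimes>\<^sub>M q) borel ((\<lambda>(x, y). x + y) \<circ> (\<lambda>(x, y). (z x, y)))"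
    by (rule distr_distr) measurable
  also have "(\<lambda>(x, y). x + y) \<circ> (\<lambda>(x, y). (z x, y)) = W"
    by (auto simp: fun_eq_iff W_def)
  finally show ?thesis ..
qed

sublocale R: real_distribution "convolution (distr \<mu> borel z) q"
  unfolding law_W[symmetric] by (rule P.real_distribution_distr) measurable

lemma law_N: "distr (\<mu> \<Otimes>\<^sub>M q) borel N = \<nu>"
  using target_law unfolding N_def T_def W_def by (simp add: case_prod_beta')

lemma AE_W_ne: "AE \<omega> in \<mu> \<Otimes>\<^sub>M q. W \<omega> \<noteq> s"
proof (rule P.AE_pair_measure)
  show "{\<omega> \<in> space (\<mu> \<Otimes>\<^sub>M q). W \<omega> \<noteq> s} \<in> sets (\<mu> \<Otimes>\<^sub>M q)" by measurable
  have "AE y in q. W (x, y) \<noteq> s" for x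
  proof (rule AE_I'[of "{s - z x}"])
    show "{s - z x} \<in> null_sets q"
      using atomless_noise by (auto simp: null_sets_def Q.emeasure_eq_measure)
  qed (auto simp: W_def)
  then show "AE x in \<mu>. AE y in q. W (x, y) \<noteq> s" by simp
qed

lemma atomless_convolution: "measure (convolution (distr \<mu> borel z) q) {w} = 0"
proof -
  have "AE v in convolution (distr \<mu> borel z) q. v \<noteq> w"
    unfolding law_W[symmetric] using AE_W_ne[of w] by (subst AE_distr_iff) auto
  then show ?thesis
    by (subst (asm) AE_iff_measurable[of "{w}"]) (auto simp: measure_def)
qed

lemma continuous_F: "continuous_on UNIV F"
  using R.isCont_cdf atomless_convolution by (simp add: F_def continuous_at_imp_continuous_on)

lemma F_mono: "v \<le> w \<Longrightarrow> F v \<le> F w"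
  unfolding F_def by (rule R.cdf_nondecreasing)

text \<open>Where \<open>F\<close> is 0 or 1, \<open>T\<close> is an end point of the support of \<open>\<nu>\<close>, and \<open>real_of_ereal\<close> turns an infinite end point
into 0. So \<open>T\<close> need not be increasing on the whole line, but it is on \<open>D\<close>, where \<open>W\<close> lives almost surely.\<close>

definition D :: "real set" where
  "D = {w. 0 < F w \<and> F w < 1}"

lemma AE_W_in_D: "AE \<omega> in \<mu> \<Otimes>\<^sub>M q. W \<omega> \<in> D"
proof -
  have "AE w in distr (\<mu> \<Otimes>\<^sub>M q) borel W. w \<in> D"
    using R.AE_cdf_strictly_between[OF atomless_convolution] unfolding law_W by (simp add: D_def F_def)
  then show ?thesis by (rule AE_distrD[rotated]) measurable
qed

lemma T_eq_Inf: "w \<in> D \<Longrightarrow> T w = Inf {y. F w \<le> cdf \<nu> y}"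
  by (simp add: T_def D_def F_def bass_map_def quantile_def)

text \<open>\<open>T\<close> determines \<open>F\<close>: since \<open>\<nu>\<close> has no atoms, its distribution function is a left inverse of the quantile
function.\<close>

lemma cdf_target_T: "w \<in> D \<Longrightarrow> cdf \<nu> (T w) = F w"
  using NU.cdf_quantile[OF atomless_target, of "F w"] by (simp add: T_eq_Inf) (simp add: D_def)

lemma T_mono_on: "mono_on D T"
proof (rule mono_onI)
  interpret cdf_distribution \<nu> by unfold_locales
  fix v w assume vw: "v \<in> D" "w \<in> D" "v \<le> w"
  show "T v \<le> T w"
    using mono_onD[OF mono_I, of "F v" "F w"] vw F_mono[OF vw(3)]
    by (simp add: T_eq_Inf) (simp add: D_def)
qed

lemma integrable_N:
  fixes f :: "real \<Rightarrow> real"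
  assumes "f \<in> borel_measurable borel" "integrable \<nu> f"
  shows "integrable (\<mu> \<Otimes>\<^sub>M q) (\<lambda>\<omega>. f (N \<omega>))"
  using integrable_distr[of N "\<mu> \<Otimes>\<^sub>M q" borel f] assms(2) unfolding law_N by simp

lemma integrable_fst_times_N:
  assumes [measurable]: "h \<in> borel_measurable borel" and "bounded (range h)"
  shows "integrable (\<mu> \<Otimes>\<^sub>M q) (\<lambda>\<omega>. h (fst \<omega>) * N \<omega>)"
proof -
  obtain B where B: "\<And>x. \<bar>h x\<bar> \<le> B" using assms(2) by (auto simp: bounded_iff)
  show ?thesis
  proof (rule Bochner_Integration.integrable_bound)
    show "integrable (\<mu> \<Otimes>\<^sub>M q) (\<lambda>\<omega>. B * N \<omega>)"
      using integrable_N[OF _ integrable_target] by simp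
    show "AE \<omega> in \<mu> \<Otimes>\<^sub>M q. norm (h (fst \<omega>) * N \<omega>) \<le> norm (B * N \<omega>)"
      using order_trans[OF B abs_ge_self] by (auto simp: abs_mult intro!: mult_right_mono)
  qed measurable
qed

text \<open>The moment conditions on \<open>\<nu>\<close> and \<open>q\<close> serve to make the covariance of the noise and the martingale finite.\<close>

lemma integrable_snd_times_N: "integrable (\<mu> \<Otimes>\<^sub>M q) (\<lambda>\<omega>. snd \<omega> * N \<omega>)"
proof (rule integrable_mult_of_powr[OF _ _ _ exponents])
  show "integrable (\<mu> \<Otimes>\<^sub>M q) (\<lambda>\<omega>. \<bar>N \<omega>\<bar> powr a)"
    using integrable_N[OF _ moments(1)] by simp
  show "integrable (\<mu> \<Otimes>\<^sub>M q) (\<lambda>\<omega>. \<bar>snd \<omega>\<bar> powr b)"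
    by (rule P.Fubini_integrable) (use moments(2) in \<open>simp_all, measurable\<close>)
  show "finite_measure (\<mu> \<Otimes>\<^sub>M q)" by (rule P.finite_measure_axioms)
qed measurable

lemma integrable_kernel: "0 < measure \<mu> {x} \<Longrightarrow> integrable q (\<lambda>y. N (x, y))"
  using star_defined_atom[of x] by (simp add: star_defined_def N_def T_def W_def)

lemma integral_kernel: "0 < measure \<mu> {x} \<Longrightarrow> (\<integral>y. N (x, y) \<partial>q) = x"
  using star_atom[of x] by (simp add: star_def N_def T_def W_def)

text \<open>Starting from the atom \<open>x\<close>, the process ends just to the right of \<open>z x + y\<close> with positive probability, because
the support of \<open>q\<close> contains the whole interval from \<open>y\<close> to \<open>y'\<close>.\<close>

lemma F_strictly_increases:
  assumes conv: "is_interval (supp q)" and x: "0 < measure \<mu> {x}"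
    and y: "y \<in> supp q" "y' \<in> supp q" "y < y'" and v: "z x + y < v"
  shows "F (z x + y) < F v"
proof -
  define c where "c = min y' (v - z x)"
  have c: "y < c" "c \<le> y'" "z x + c \<le> v" using y v by (auto simp: c_def)
  have "(y + c) / 2 \<in> supp q"
    using mem_is_interval_1_I[OF conv y(1,2), of "(y + c) / 2"] c by simp
  then have "0 < emeasure q {y<..<c}"
    using c(1) unfolding supp_def by (auto dest!: spec[of _ "{y<..<c}"])
  moreover have "{x} \<in> sets \<mu>" by simp
  ultimately have "0 < emeasure (\<mu> \<Otimes>\<^sub>M q) ({x} \<times> {y<..<c})"
    using x by (subst Q.emeasure_pair_measure_Times) (auto simp: X.emeasure_eq_measure ennreal_zero_less_mult_iff)
  also have "\<dots> \<le> emeasure (\<mu> \<Otimes>\<^sub>M q) (W -` {z x + y<..v} \<inter> space (\<mu> \<Otimes>\<^sub>M q))"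
  proof (rule emeasure_mono)
    show "{x} \<times> {y<..<c} \<subseteq> W -` {z x + y<..v} \<inter> space (\<mu> \<Otimes>\<^sub>M q)"
      using c by (auto simp: W_def space_pair_measure)
  qed measurable
  also have "\<dots> = emeasure (convolution (distr \<mu> borel z) q) {z x + y<..v}"
    unfolding law_W[symmetric] by (subst emeasure_distr) auto
  also have "\<dots> = ennreal (F v - F (z x + y))"
    unfolding F_def using v by (intro R.emeasure_Ioc) simp
  finally show ?thesis by (simp add: ennreal_zero_less_mult_iff)
qed

text \<open>If, conditionally on its starting value, the martingale stays on one side of \<open>p\<close>, then \<open>max (\<cdot> - p) 0\<close> is
affine on the range of each conditional law, and Jensen's inequality is an equality.\<close>

lemma call_function_eq_if_split:
  assumes low: "\<And>x. 0 < measure \<mu> {x} \<Longrightarrow> (AE y in q. N (x, y) \<le> p) \<or> (AE y in q. p \<le> N (x, y))"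
  shows "call_function \<nu> p = call_function \<mu> p"
proof -
  have int: "integrable (\<mu> \<Otimes>\<^sub>M q) (\<lambda>\<omega>. max (N \<omega> - p) 0)"
  proof (rule integrable_N[of "\<lambda>y. max (y - p) 0"])
    show "integrable \<nu> (\<lambda>y. max (y - p) 0)"
    proof (rule Bochner_Integration.integrable_bound)
      show "integrable \<nu> (\<lambda>y. \<bar>y\<bar> + \<bar>p\<bar>)"
        by (intro Bochner_Integration.integrable_add integrable_abs integrable_target) simp
      have "\<bar>max (y - p) 0\<bar> \<le> \<bar>\<bar>y\<bar> + \<bar>p\<bar>\<bar>" for y :: real by linarith
      then show "AE y in \<nu>. norm (max (y - p) 0) \<le> norm (\<bar>y\<bar> + \<bar>p\<bar>)" by simp
    qed measurable
    show "(\<lambda>y. max (y - p) 0) \<in> borel_measurable borel"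
      by (intro borel_measurable_max borel_measurable_diff) auto
  qed
  have kernel: "(\<integral>y. max (N (x, y) - p) 0 \<partial>q) = max (x - p) 0" if x: "0 < measure \<mu> {x}" for x
    using low[OF x]
  proof (rule disjE)
    assume le: "AE y in q. N (x, y) \<le> p"
    have "x \<le> p"
      using integral_mono_AE[OF integrable_kernel[OF x] _ le] by (simp add: integral_kernel[OF x] prob_noise_UNIV)
    moreover have "(\<integral>y. max (N (x, y) - p) 0 \<partial>q) = 0"
      by (rule integral_eq_zero_AE) (use le in eventually_elim, simp)
    ultimately show ?thesis by simp
  next
    assume ge: "AE y in q. p \<le> N (x, y)"
    have "p \<le> x"
      using integral_mono_AE[OF _ integrable_kernel[OF x] ge] by (simp add: integral_kernel[OF x] prob_noise_UNIV)
    moreover have "(\<integral>y. max (N (x, y) - p) 0 \<partial>q) = (\<integral>y. N (x, y) - p \<partial>q)"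
    proof (rule integral_cong_AE)
      show "(\<lambda>y. max (N (x, y) - p) 0) \<in> borel_measurable q" "(\<lambda>y. N (x, y) - p) \<in> borel_measurable q"
        using borel_measurable_integrable[OF integrable_kernel[OF x]] by measurable
      show "AE y in q. max (N (x, y) - p) 0 = N (x, y) - p" using ge by eventually_elim simp
    qed
    ultimately show ?thesis
      using integrable_kernel[OF x] by (simp add: integral_kernel[OF x] prob_noise_UNIV)
  qed
  have "call_function \<nu> p = (\<integral>\<omega>. max (N \<omega> - p) 0 \<partial>(\<mu> \<Otimes>\<^sub>M q))"
    using integral_distr[of N "\<mu> \<Otimes>\<^sub>M q" borel "\<lambda>y. max (y - p) 0"]
    by (simp add: call_function_def law_N)
  also have "\<dots> = (\<integral>x. (\<integral>y. max (N (x, y) - p) 0 \<partial>q) \<partial>\<mu>)"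
    using P.integral_fst'[OF int] by simp
  also have "\<dots> = (\<integral>x. max (x - p) 0 \<partial>\<mu>)"
  proof (rule integral_cong_AE)
    show "AE x in \<mu>. (\<integral>y. max (N (x, y) - p) 0 \<partial>q) = max (x - p) 0"
      using atomic by eventually_elim (rule kernel)
  qed measurable
  finally show ?thesis by (simp add: call_function_def)
qed

text \<open>If the process started at \<open>z x\<close> could never end strictly to the right of where it may end when started at \<open>z x'\<close>,
then, \<open>T\<close> being increasing, some level \<open>p\<close> between \<open>x\<close> and \<open>x'\<close> would separate the end values of the martingale
started at atoms up to \<open>x\<close> from those started at atoms from \<open>x'\<close> on. The call functions of \<open>\<mu>\<close> and \<open>\<nu>\<close> would then
meet at \<open>p\<close>, although the interval on which they differ contains the atoms \<open>x\<close> and \<open>x'\<close>.\<close>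

lemma irreducible_imp_supports_overlap:
  assumes irr: "irreducible_pair \<mu> \<nu>" and x: "0 < measure \<mu> {x}" "0 < measure \<mu> {x'}" "x < x'"
    and consecutive: "\<And>w. 0 < measure \<mu> {w} \<Longrightarrow> w \<le> x \<or> x' \<le> w"
  shows "\<exists>y\<in>supp q. \<exists>y'\<in>supp q. z x' + y' < z x + y"
proof (rule ccontr)
  assume "\<not> ?thesis"
  then have apart: "z x + y \<le> z x' + y'" if "y \<in> supp q" "y' \<in> supp q" for y y'
    using that by (auto simp: not_less)
  define G where "G w = {y \<in> supp q. z w + y \<in> D}" for w
  have AE_G: "AE y in q. y \<in> G w" if "0 < measure \<mu> {w}" for w
    using AE_pair_at_atom[OF AE_W_in_D that] AE_in_supp[OF Q.events_eq_borel]
    by eventually_elim (simp add: G_def W_def)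
  have G_ne: "G w \<noteq> {}" if "0 < measure \<mu> {w}" for w
  proof
    assume "G w = {}"
    then have "AE y in q. False" using AE_G[OF that] by simp
    then show False by simp
  qed
  have position_le: "z v \<le> z w" if "v \<le> w" "0 < measure \<mu> {v}" "0 < measure \<mu> {w}" for v w
    using strict_mono_on_leD[OF position_strict_mono] that by simp
  define p where "p = (INF y\<in>G x'. T (z x' + y))"
  have below: "T (z w + y) \<le> T (z x' + y')"
    if "0 < measure \<mu> {w}" "w \<le> x" "y \<in> G w" "y' \<in> G x'" for w y y'
  proof (rule mono_onD[OF T_mono_on])
    show "z w + y \<in> D" "z x' + y' \<in> D" using that by (auto simp: G_def)
    have "z w + y \<le> z x + y" using position_le that x by simp
    also have "\<dots> \<le> z x' + y'" using that by (intro apart) (auto simp: G_def)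
    finally show "z w + y \<le> z x' + y'" .
  qed
  have low: "T (z w + y) \<le> p" if "0 < measure \<mu> {w}" "w \<le> x" "y \<in> G w" for w y
    unfolding p_def using G_ne[OF x(2)] below[OF that] by (rule cINF_greatest)
  obtain y0 where y0: "y0 \<in> G x" using G_ne[OF x(1)] by auto
  have bdd: "bdd_below ((\<lambda>y. T (z x' + y)) ` G x')"
    using below[OF x(1) order_refl y0] by (intro bdd_belowI2)
  have high: "p \<le> T (z w + y)" if "0 < measure \<mu> {w}" "x' \<le> w" "y \<in> G w" "y \<in> G x'" for w y
  proof -
    have "p \<le> T (z x' + y)" unfolding p_def using bdd that(4) by (rule cINF_lower)
    also have "\<dots> \<le> T (z w + y)"
      using that position_le[of x' w] x by (intro mono_onD[OF T_mono_on]) (auto simp: G_def)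
    finally show ?thesis .
  qed
  have AE_low: "AE y in q. N (w, y) \<le> p" if "0 < measure \<mu> {w}" "w \<le> x" for w
    using AE_G[OF that(1)] by eventually_elim (simp add: N_def W_def low that)
  have AE_high: "AE y in q. p \<le> N (w, y)" if "0 < measure \<mu> {w}" "x' \<le> w" for w
    using AE_G[OF that(1)] AE_G[OF x(2)] by eventually_elim (simp add: N_def W_def high that)
  have calls: "call_function \<nu> p = call_function \<mu> p"
    using consecutive AE_low AE_high by (intro call_function_eq_if_split) blast
  define I where "I = {x. call_function \<mu> x < call_function \<nu> x}"
  have I: "is_interval I" "emeasure \<mu> I = 1" using irr by (auto simp: irreducible_pair_def I_def Let_def)
  have "I \<in> sets \<mu>"
  proof (rule ccontr)
    assume "I \<notin> sets \<mu>"
    then show False using I(2) emeasure_notin_sets[of I \<mu>] by simp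
  qed
  then have "AE v in \<mu>. v \<in> I" using I(2) by (intro X.AE_prob_1) (simp add: X.emeasure_eq_measure)
  then have "x \<in> I" "x' \<in> I" using X.AE_at_atom x(1,2) by blast+
  moreover have "x \<le> p"
    using integral_mono_AE[OF integrable_kernel[OF x(1)] _ AE_low[OF x(1)]]
    by (simp add: integral_kernel[OF x(1)] prob_noise_UNIV)
  moreover have "p \<le> x'"
    using integral_mono_AE[OF _ integrable_kernel[OF x(2)] AE_high[OF x(2)]]
    by (simp add: integral_kernel[OF x(2)] prob_noise_UNIV)
  ultimately have "p \<in> I" using mem_is_interval_1_I[OF I(1)] by blast
  then show False using calls by (simp add: I_def)
qed

end

section \<open>Comparing two Bass martingales\<close>

locale two_bass_solutions =
  A: bass_solution \<mu> \<nu> q a b z + B: bass_solution \<mu> \<nu> q a b z' for \<mu> \<nu> q a b z z'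
begin

text \<open>The difference \<open>W - W'\<close> of the two processes is a function of the starting value alone, given which \<open>N\<close>
and \<open>N'\<close> have the same mean, by the martingale property.\<close>

lemma expected_displacement_times_difference:
  "(\<integral>\<omega>. (A.W \<omega> - B.W \<omega>) * (A.N \<omega> - B.N \<omega>) \<partial>(\<mu> \<Otimes>\<^sub>M q)) = 0"
proof -
  have *: "(\<lambda>\<omega>. (A.W \<omega> - B.W \<omega>) * (A.N \<omega> - B.N \<omega>)) =
      (\<lambda>\<omega>. (z (fst \<omega>) * A.N \<omega> - z' (fst \<omega>) * A.N \<omega>) - (z (fst \<omega>) * B.N \<omega> - z' (fst \<omega>) * B.N \<omega>))"
    by (simp add: fun_eq_iff A.W_def B.W_def algebra_simps)
  have int: "integrable (\<mu> \<Otimes>\<^sub>M q) (\<lambda>\<omega>. (A.W \<omega> - B.W \<omega>) * (A.N \<omega> - B.N \<omega>))"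
    unfolding *
    by (intro Bochner_Integration.integrable_diff A.integrable_fst_times_N B.integrable_fst_times_N
        A.position_measurable B.position_measurable A.position_bounded B.position_bounded)
  have "(\<integral>y. (A.W (x, y) - B.W (x, y)) * (A.N (x, y) - B.N (x, y)) \<partial>q) = 0"
    if x: "0 < measure \<mu> {x}" for x
  proof -
    have "(\<integral>y. (A.W (x, y) - B.W (x, y)) * (A.N (x, y) - B.N (x, y)) \<partial>q) =
        (\<integral>y. (z x - z' x) * (A.N (x, y) - B.N (x, y)) \<partial>q)"
      by (simp add: A.W_def B.W_def)
    also have "\<dots> = (z x - z' x) * ((\<integral>y. A.N (x, y) \<partial>q) - (\<integral>y. B.N (x, y) \<partial>q))"
      using A.integrable_kernel[OF x] B.integrable_kernel[OF x] by simp
    finally show ?thesis by (simp add: A.integral_kernel[OF x] B.integral_kernel[OF x])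
  qed
  then have "AE x in \<mu>. (\<integral>y. (A.W (x, y) - B.W (x, y)) * (A.N (x, y) - B.N (x, y)) \<partial>q) = 0"
    using A.atomic by (auto elim!: eventually_mono)
  then have "(\<integral>x. (\<integral>y. (A.W (x, y) - B.W (x, y)) * (A.N (x, y) - B.N (x, y)) \<partial>q) \<partial>\<mu>) = 0"
    by (rule integral_eq_zero_AE)
  then show ?thesis using A.P.integral_fst'[OF int] by simp
qed

text \<open>Each of \<open>N\<close> and \<open>N'\<close> is the optimal partner of its own process among the variables of law \<open>\<nu>\<close>, so both gains
\<open>E (W (N - N'))\<close> and \<open>E (W' (N' - N))\<close> are nonnegative. Their sum \<open>E ((W - W') (N - N'))\<close> vanishes, hence so does
each of them, and the optimal partner is unique.\<close>

lemma same_martingale: "AE \<omega> in \<mu> \<Otimes>\<^sub>M q. A.N \<omega> = B.N \<omega>"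
proof -
  have split: "(\<lambda>\<omega>. A.W \<omega> * (A.N \<omega> - B.N \<omega>)) =
      (\<lambda>\<omega>. (z (fst \<omega>) * A.N \<omega> + snd \<omega> * A.N \<omega>) - (z (fst \<omega>) * B.N \<omega> + snd \<omega> * B.N \<omega>))"
    "(\<lambda>\<omega>. B.W \<omega> * (B.N \<omega> - A.N \<omega>)) =
      (\<lambda>\<omega>. (z' (fst \<omega>) * B.N \<omega> + snd \<omega> * B.N \<omega>) - (z' (fst \<omega>) * A.N \<omega> + snd \<omega> * A.N \<omega>))"
    by (simp_all add: fun_eq_iff A.W_def B.W_def algebra_simps)
  have int: "integrable (\<mu> \<Otimes>\<^sub>M q) (\<lambda>\<omega>. A.W \<omega> * (A.N \<omega> - B.N \<omega>))"
    "integrable (\<mu> \<Otimes>\<^sub>M q) (\<lambda>\<omega>. B.W \<omega> * (B.N \<omega> - A.N \<omega>))"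
    unfolding split
    by (intro Bochner_Integration.integrable_diff Bochner_Integration.integrable_add
        A.integrable_fst_times_N B.integrable_fst_times_N A.integrable_snd_times_N B.integrable_snd_times_N
        A.position_measurable B.position_measurable A.position_bounded B.position_bounded)+
  have law: "distr (\<mu> \<Otimes>\<^sub>M q) borel A.N = distr (\<mu> \<Otimes>\<^sub>M q) borel B.N"
    by (rule trans[OF A.law_N B.law_N[symmetric]])
  have AE: "AE \<omega> in \<mu> \<Otimes>\<^sub>M q. A.W \<omega> \<in> A.D \<and> A.N \<omega> = A.T (A.W \<omega>)"
    "AE \<omega> in \<mu> \<Otimes>\<^sub>M q. B.W \<omega> \<in> B.D \<and> B.N \<omega> = B.T (B.W \<omega>)"
    using A.AE_W_in_D B.AE_W_in_D by (simp_all add: A.N_def B.N_def)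
  note optimal = A.P.increasing_image_maximizes_covariance
      [OF A.W_measurable A.N_measurable B.N_measurable A.T_mono_on AE(1) law int(1)]
    A.P.increasing_image_maximizes_covariance
      [OF B.W_measurable B.N_measurable A.N_measurable B.T_mono_on AE(2) law[symmetric] int(2)]
  have "(\<integral>\<omega>. A.W \<omega> * (A.N \<omega> - B.N \<omega>) \<partial>(\<mu> \<Otimes>\<^sub>M q)) + (\<integral>\<omega>. B.W \<omega> * (B.N \<omega> - A.N \<omega>) \<partial>(\<mu> \<Otimes>\<^sub>M q)) =
      (\<integral>\<omega>. (A.W \<omega> - B.W \<omega>) * (A.N \<omega> - B.N \<omega>) \<partial>(\<mu> \<Otimes>\<^sub>M q))"
    by (subst Bochner_Integration.integral_add[OF int, symmetric]) (simp add: algebra_simps)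
  then have "(\<integral>\<omega>. A.W \<omega> * (A.N \<omega> - B.N \<omega>) \<partial>(\<mu> \<Otimes>\<^sub>M q)) = 0"
    using expected_displacement_times_difference optimal(1) optimal(3) by linarith
  then show ?thesis by (rule optimal(2)[OF A.AE_W_ne])
qed

lemma same_distribution_function:
  assumes x: "0 < measure \<mu> {x}" and y: "y \<in> supp q"
  shows "A.F (z x + y) = B.F (z' x + y)"
proof (rule AE_eq_imp_eq_on_supp[OF A.Q.events_eq_borel _ _ _ y])
  show "continuous_on UNIV (\<lambda>y. A.F (z x + y))" "continuous_on UNIV (\<lambda>y. B.F (z' x + y))"
    by (auto intro!: continuous_on_compose2[OF A.continuous_F] continuous_on_compose2[OF B.continuous_F]
        continuous_intros)
  show "AE y in q. A.F (z x + y) = B.F (z' x + y)"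
    using A.AE_pair_at_atom[OF A.AE_W_in_D x] A.AE_pair_at_atom[OF B.AE_W_in_D x]
      A.AE_pair_at_atom[OF same_martingale x]
  proof eventually_elim
    case (elim y)
    then show ?case
      using A.cdf_target_T[of "z x + y"] B.cdf_target_T[of "z' x + y"]
      by (simp add: A.N_def B.N_def A.W_def B.W_def)
  qed
qed

text \<open>A point \<open>w\<close> that can be reached from both \<open>z x\<close> and \<open>z x'\<close> gives two points \<open>w + (z' x - z x)\<close> and
\<open>w + (z' x' - z x')\<close> at which the second distribution function has the value that the first one has at \<open>w\<close>. That
function is strictly increasing there, so the two points coincide.\<close>

lemma same_displacement_if_overlap:
  assumes conv: "is_interval (supp q)"
    and x: "0 < measure \<mu> {x}" "0 < measure \<mu> {x'}" "x < x'"
    and y: "y \<in> supp q" "y' \<in> supp q" "z x' + y' < z x + y"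
  shows "z' x - z x = z' x' - z x'"
proof -
  have le: "z x < z x'" using strict_mono_onD[OF A.position_strict_mono] x by simp
  have between: "u \<in> supp q" if "y' \<le> u" "u \<le> y" for u
    using mem_is_interval_1_I[OF conv y(2,1) that] .
  \<comment> \<open>Both \<open>z x + u = z x' + y'\<close> and \<open>z x + y = z x' + v\<close> are reachable from either side. The first serves as the
    point \<open>w\<close>; the second provides the room to its right that makes the distribution function increase strictly.\<close>
  define u where "u = y' + (z x' - z x)"
  define v where "v = y - (z x' - z x)"
  have in_supp: "u \<in> supp q" "v \<in> supp q"
    using le y(3) by (auto simp: u_def v_def intro!: between)
  have "z x + u = z x' + y'" by (simp add: u_def)
  then have F_u: "B.F (z' x + u) = B.F (z' x' + y')"
    using same_distribution_function[OF x(1) in_supp(1)] same_distribution_function[OF x(2) y(2)] by simp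
  have "z' x + u = z' x' + y'"
  proof (rule ccontr)
    assume "z' x + u \<noteq> z' x' + y'"
    then consider "z' x + u < z' x' + y'" | "z' x' + y' < z' x + u" by linarith
    then show False
    proof cases
      case 1
      then show False
        using B.F_strictly_increases[OF conv x(1) in_supp(1) y(1) _ 1] F_u y(3) by (simp add: u_def)
    next
      case 2
      then show False
        using B.F_strictly_increases[OF conv x(2) y(2) in_supp(2) _ 2] F_u y(3) by (simp add: v_def)
    qed
  qed
  then show ?thesis by (simp add: u_def)
qed

text \<open>Otherwise take the first atom whose displacement differs from that of the smallest atom, together with its
predecessor: these neighbours have overlapping supports and so equal displacements.\<close>

lemma same_displacement:
  assumes conv: "is_interval (supp q)" and irr: "irreducible_pair \<mu> \<nu>"
    and fin: "finite {x. 0 < measure \<mu> {x}}"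
  shows "\<exists>c. \<forall>x. 0 < measure \<mu> {x} \<longrightarrow> z' x = z x + c"
proof -
  define At where "At = {x. 0 < measure \<mu> {x}}"
  have "At \<noteq> {}"
  proof
    assume "At = {}"
    then have "AE x in \<mu>. False" using A.atomic by (simp add: At_def)
    then show False by simp
  qed
  then have m: "Min At \<in> At" "\<And>x. x \<in> At \<Longrightarrow> Min At \<le> x" using fin by (auto simp: At_def[symmetric])
  define c where "c = z' (Min At) - z (Min At)"
  define Bad where "Bad = {x \<in> At. z' x - z x \<noteq> c}"
  have "Bad = {}"
  proof (rule ccontr)
    assume ne: "Bad \<noteq> {}"
    have finB: "finite Bad" using fin by (simp add: Bad_def At_def)
    define x' where "x' = Min Bad"
    have x': "x' \<in> Bad" "\<And>w. w \<in> Bad \<Longrightarrow> x' \<le> w" using Min_in[OF finB ne] Min_le[OF finB] by (auto simp: x'_def)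
    define L where "L = {w \<in> At. w < x'}"
    have finL: "finite L" using fin by (simp add: L_def At_def)
    have "Min At \<noteq> x'" using x'(1) by (auto simp: Bad_def c_def)
    then have neL: "L \<noteq> {}" using m x'(1) by (force simp: L_def Bad_def)
    define x where "x = Max L"
    have x: "x \<in> L" "\<And>w. w \<in> L \<Longrightarrow> w \<le> x" using Max_in[OF finL neL] Max_ge[OF finL] by (auto simp: x_def)
    have atoms: "0 < measure \<mu> {x}" "0 < measure \<mu> {x'}" "x < x'"
      using x(1) x'(1) by (auto simp: L_def At_def Bad_def)
    have "w \<le> x \<or> x' \<le> w" if "0 < measure \<mu> {w}" for w
      using that x(2)[of w] by (auto simp: L_def At_def)
    then obtain y y' where y: "y \<in> supp q" "y' \<in> supp q" "z x' + y' < z x + y"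
      using A.irreducible_imp_supports_overlap[OF irr atoms] by blast
    have "z' x - z x = z' x' - z x'"
      by (rule same_displacement_if_overlap[OF conv atoms y])
    moreover have "z' x - z x = c"
    proof (rule ccontr)
      assume "z' x - z x \<noteq> c"
      then have "x \<in> Bad" using x(1) by (simp add: Bad_def L_def)
      then show False using x'(2)[of x] atoms(3) by simp
    qed
    ultimately show False using x'(1) by (simp add: Bad_def)
  qed
  then have "z' x = z x + c" if "0 < measure \<mu> {x}" for x
    using that by (auto simp: Bad_def At_def algebra_simps)
  then show ?thesis by blast
qed

end

section \<open>Bass measures as images of the initial law\<close>

text \<open>The map \<open>g = q \<star> T\<close> pushes \<open>\<alpha>\<close> forward to \<open>\<mu>\<close> and is strictly increasing on a set of full measure. Hence \<open>\<alpha>\<close>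
sits on the finitely many points that \<open>g\<close> sends to atoms of \<open>\<mu>\<close>, and \<open>z\<close> is the inverse of \<open>g\<close> on them.\<close>

lemma bass_measure_positions:
  assumes mu: "real_distribution \<mu>" and nu: "real_distribution \<nu>" and q: "real_distribution q"
    and fin: "finite {x. 0 < measure \<mu> {x}}" and atomic: "AE x in \<mu>. 0 < measure \<mu> {x}"
    and bass: "bass_measure q \<mu> \<nu> \<alpha>"
  obtains z where "z \<in> borel_measurable borel" "finite (range z)" "\<alpha> = distr \<mu> borel z"
    "strict_mono_on {x. 0 < measure \<mu> {x}} z"
    "distr (\<mu> \<Otimes>\<^sub>M q) borel (\<lambda>(x, y). real_of_ereal (bass_map q \<nu> \<alpha> (z x + y))) = \<nu>"
    "\<And>x. 0 < measure \<mu> {x} \<Longrightarrow> star_defined q (bass_map q \<nu> \<alpha>) (z x)"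
    "\<And>x. 0 < measure \<mu> {x} \<Longrightarrow> star q (bass_map q \<nu> \<alpha>) (z x) = x"
proof -
  interpret X: real_distribution \<mu> by (rule mu)
  interpret Q: real_distribution q by (rule q)
  define T where "T = bass_map q \<nu> \<alpha>"
  define g where "g = star q T"
  obtain \<pi> where \<pi>: "\<pi> \<in> martingale_couplings \<mu> \<nu>" and rep: "represents_bass q \<nu> \<alpha> \<pi>"
    using bass by (auto simp: bass_measure_def bass_martingale_def)
  have alpha: "real_distribution \<alpha>"
    and \<pi>_eq: "\<pi> = distr (\<alpha> \<Otimes>\<^sub>M q) (borel \<Otimes>\<^sub>M borel) (\<lambda>(x, y). (g x, real_of_ereal (T (x + y))))"
    using rep by (auto simp: represents_bass_def Let_def T_def g_def)
  obtain S where S: "S \<in> sets borel" "emeasure \<alpha> S = 1" "\<And>x. x \<in> S \<Longrightarrow> star_defined q T x"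
    "strict_mono_on S g"
    using rep by (auto simp: represents_bass_def Let_def T_def g_def)
  interpret AL: real_distribution \<alpha> by (rule alpha)
  interpret AQ: pair_prob_space \<alpha> q ..
  have [measurable]: "(\<lambda>w. real_of_ereal (T w)) \<in> borel_measurable borel"
    unfolding T_def by (rule borel_measurable_bass_map[OF nu alpha q])
  have g_meas [measurable]: "g \<in> borel_measurable borel"
    unfolding g_def star_def by measurable
  have \<mu>_eq: "\<mu> = distr \<alpha> borel g"
  proof -
    have "\<mu> = distr \<pi> borel fst" using \<pi> by (simp add: martingale_couplings_def)
    also have "\<dots> = distr (\<alpha> \<Otimes>\<^sub>M q) borel (fst \<circ> (\<lambda>(x, y). (g x, real_of_ereal (T (x + y)))))"
      unfolding \<pi>_eq by (rule distr_distr) measurable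
    also have "\<dots> = distr (\<alpha> \<Otimes>\<^sub>M q) borel (g \<circ> fst)"
      by (rule arg_cong[of _ _ "distr _ _"]) (auto simp: fun_eq_iff)
    also have "\<dots> = distr (distr (\<alpha> \<Otimes>\<^sub>M q) \<alpha> fst) borel g"
      by (rule distr_distr[symmetric]) measurable
    also have "distr (\<alpha> \<Otimes>\<^sub>M q) \<alpha> fst = \<alpha>" by (rule Q.distr_pair_fst)
    finally show ?thesis .
  qed
  have \<nu>_eq: "distr (\<alpha> \<Otimes>\<^sub>M q) borel (\<lambda>(x, y). real_of_ereal (T (x + y))) = \<nu>"
  proof -
    have "\<nu> = distr \<pi> borel snd" using \<pi> by (simp add: martingale_couplings_def)
    also have "\<dots> = distr (\<alpha> \<Otimes>\<^sub>M q) borel (snd \<circ> (\<lambda>(x, y). (g x, real_of_ereal (T (x + y)))))"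
      unfolding \<pi>_eq by (rule distr_distr) measurable
    also have "\<dots> = distr (\<alpha> \<Otimes>\<^sub>M q) borel (\<lambda>(x, y). real_of_ereal (T (x + y)))"
      by (rule arg_cong[of _ _ "distr _ _"]) (auto simp: fun_eq_iff)
    finally show ?thesis ..
  qed
  define S0 where "S0 = {s \<in> S. 0 < measure \<mu> {g s}}"
  have inj: "inj_on g S0"
    using strict_mono_on_imp_inj_on[OF S(4)] by (rule inj_on_subset) (auto simp: S0_def)
  have fin0: "finite S0"
    by (rule finite_imageD[OF finite_subset[OF _ fin] inj]) (auto simp: S0_def)
  have "AE s in \<alpha>. s \<in> S" using S(1,2) by (intro AL.AE_prob_1) (simp add: AL.emeasure_eq_measure)
  moreover have "AE s in \<alpha>. 0 < measure \<mu> {g s}"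
  proof (rule AE_distrD[of g \<alpha> borel "\<lambda>x. 0 < measure \<mu> {x}"])
    show "AE x in distr \<alpha> borel g. 0 < measure \<mu> {x}" unfolding \<mu>_eq[symmetric] by (rule atomic)
  qed simp
  ultimately have AE0: "AE s in \<alpha>. s \<in> S0" by eventually_elim (simp add: S0_def)
  \<comment> \<open>The inverse of \<open>g\<close>, written as a finite sum so that its measurability is evident; it is 0 off the atoms.\<close>
  define z where "z x = (\<Sum>s\<in>S0. if x = g s then s else 0)" for x
  have z_g: "z (g s) = s" if "s \<in> S0" for s
  proof -
    have "z (g s) = (\<Sum>t\<in>S0. if t = s then t else 0)"
      unfolding z_def
    proof (rule sum.cong)
      show "(if g s = g t then t else 0) = (if t = s then t else 0)" if "t \<in> S0" for t
        using inj_on_eq_iff[OF inj \<open>s \<in> S0\<close> that] by simp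
    qed simp
    then show ?thesis using that fin0 by simp
  qed
  have z_meas [measurable]: "z \<in> borel_measurable borel" unfolding z_def by measurable
  have "range z \<subseteq> insert 0 S0"
  proof
    fix v assume "v \<in> range z"
    then obtain x where x: "v = z x" by auto
    show "v \<in> insert 0 S0"
    proof (cases "x \<in> g ` S0")
      case False
      then have "z x = 0" unfolding z_def by (intro sum.neutral) auto
      then show ?thesis using x by simp
    qed (use z_g x in auto)
  qed
  then have fin_z: "finite (range z)" using fin0 finite_subset by blast
  have atom_image: "\<exists>s\<in>S0. x = g s" if "0 < measure \<mu> {x}" for x
  proof -
    have "g ` S0 \<in> sets borel" using fin0 by (intro borel_closed finite_imp_closed) simp
    then have "AE x in distr \<alpha> borel g. x \<in> g ` S0"
      using AE0 by (subst AE_distr_iff) (auto elim!: eventually_mono)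
    then have "AE x in \<mu>. x \<in> g ` S0" unfolding \<mu>_eq[symmetric] .
    then have "x \<in> g ` S0" using that by (rule X.AE_at_atom)
    then show ?thesis by auto
  qed
  have \<alpha>_eq: "\<alpha> = distr \<mu> borel z"
  proof -
    have "distr \<mu> borel z = distr \<alpha> borel (z \<circ> g)"
      by (subst \<mu>_eq, rule distr_distr) measurable
    also have "\<dots> = distr \<alpha> borel (\<lambda>s. s)"
      by (rule distr_cong_AE) (use AE0 in \<open>auto elim!: eventually_mono simp: z_g\<close>)
    also have "\<dots> = \<alpha>" by (rule distr_id2) simp
    finally show ?thesis ..
  qed
  show thesis
  proof
    show "z \<in> borel_measurable borel" by (rule z_meas)
    show "finite (range z)" by (rule fin_z)
    show "\<alpha> = distr \<mu> borel z" by (rule \<alpha>_eq)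
    show "strict_mono_on {x. 0 < measure \<mu> {x}} z"
    proof (rule strict_mono_onI)
      fix u v assume "u \<in> {x. 0 < measure \<mu> {x}}" "v \<in> {x. 0 < measure \<mu> {x}}" and less: "u < v"
      then obtain s t where st: "s \<in> S0" "t \<in> S0" "u = g s" "v = g t" using atom_image by blast
      have "s < t"
      proof (rule ccontr)
        assume "\<not> s < t"
        then have "g t \<le> g s" using strict_mono_on_leD[OF S(4), of t s] st by (simp add: S0_def)
        then show False using less st by simp
      qed
      then show "z u < z v" using st by (simp add: z_g)
    qed
    show "star_defined q (bass_map q \<nu> \<alpha>) (z x)" if "0 < measure \<mu> {x}" for x
      using atom_image[OF that] S(3) by (auto simp: z_g S0_def T_def)
    show "star q (bass_map q \<nu> \<alpha>) (z x) = x" if "0 < measure \<mu> {x}" for x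
      unfolding T_def[symmetric] g_def[symmetric] using atom_image[OF that] by (auto simp: z_g)
    have q_id: "distr q borel (\<lambda>y. y) = q" by (rule distr_id2) simp
    have "distr \<mu> borel z \<Otimes>\<^sub>M q = distr (\<mu> \<Otimes>\<^sub>M q) (borel \<Otimes>\<^sub>M borel) (\<lambda>(x, y). (z x, y))"
      by (rule pair_measure_distr[of z \<mu> borel "\<lambda>y. y" q borel, unfolded q_id, OF _ _ Q.sigma_finite_measure_axioms])
        measurable
    then have "\<alpha> \<Otimes>\<^sub>M q = distr (\<mu> \<Otimes>\<^sub>M q) (borel \<Otimes>\<^sub>M borel) (\<lambda>(x, y). (z x, y))"
      using \<alpha>_eq by simp
    then have "\<nu> = distr (distr (\<mu> \<Otimes>\<^sub>M q) (borel \<Otimes>\<^sub>M borel) (\<lambda>(x, y). (z x, y))) borel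
        (\<lambda>(x, y). real_of_ereal (T (x + y)))"
      using \<nu>_eq by simp
    also have "\<dots> = distr (\<mu> \<Otimes>\<^sub>M q) borel ((\<lambda>(x, y). real_of_ereal (T (x + y))) \<circ> (\<lambda>(x, y). (z x, y)))"
      by (rule distr_distr) measurable
    also have "(\<lambda>(x, y). real_of_ereal (T (x + y))) \<circ> (\<lambda>(x, y). (z x, y)) =
        (\<lambda>(x, y). real_of_ereal (bass_map q \<nu> \<alpha> (z x + y)))"
      by (auto simp: fun_eq_iff T_def)
    finally show "distr (\<mu> \<Otimes>\<^sub>M q) borel (\<lambda>(x, y). real_of_ereal (bass_map q \<nu> \<alpha> (z x + y))) = \<nu>" ..
  qed
qed

theorem theorem1p12:
  fixes \<mu> \<nu> q :: "real measure" and a b \<sigma> :: real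
  assumes "real_distribution \<mu>" and "real_distribution \<nu>" and "real_distribution q"
    and "integrable \<mu> (\<lambda>x. x)" and "integrable \<nu> (\<lambda>x. x)"
    and mean_zero: "(\<integral>x. x \<partial>\<nu>) = 0"
    and A1: "absolutely_continuous lborel \<nu>" "absolutely_continuous lborel q"
    and A2: "is_interval (supp \<nu>)" "is_interval (supp q)"
      "AE x in lborel. x \<in> interior (supp \<nu>) \<longrightarrow> RN_deriv lborel \<nu> x > 0"
      "AE x in lborel. x \<in> interior (supp q) \<longrightarrow> RN_deriv lborel q x > 0"
    and A3: "a > 1" "b > a / (a - 1)"
      "integrable \<nu> (\<lambda>x. \<bar>x\<bar> powr a)" "integrable q (\<lambda>x. \<bar>x\<bar> powr b)"
    and A4: "\<sigma> > 1" "quantile_deriv_in_Lp \<sigma> \<nu>"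
      "in_Lp (max ((2 * \<sigma> - 1) / (\<sigma> - 1)) (a / (a - 1))) lborel (\<lambda>x. enn2real (RN_deriv lborel q x))"
    and irreducible: "irreducible_pair \<mu> \<nu>"
    and finitely_many_atoms: "\<exists>A. finite A \<and> emeasure \<mu> A = 1"
  shows "\<forall>\<alpha> \<alpha>'. bass_measure q \<mu> \<nu> \<alpha> \<longrightarrow> bass_measure q \<mu> \<nu> \<alpha>' \<longrightarrow>
           (\<exists>c. \<alpha>' = distr \<alpha> borel (\<lambda>x. x + c))"
proof (intro allI impI)
  fix \<alpha> \<alpha>' assume bass: "bass_measure q \<mu> \<nu> \<alpha>" "bass_measure q \<mu> \<nu> \<alpha>'"
  interpret X: real_distribution \<mu> by fact
  obtain A where A: "finite A" "emeasure \<mu> A = 1" using finitely_many_atoms by blast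
  have fin: "finite {x. 0 < measure \<mu> {x}}" and atomic: "AE x in \<mu>. 0 < measure \<mu> {x}"
    using X.finite_support_atoms[OF A] by auto
  interpret P: bass_problem \<mu> \<nu> q a b
    using assms atomic A1[THEN absolutely_continuous_imp_atomless]
    by (auto simp: bass_problem_def bass_problem_axioms_def)
  obtain z where z: "z \<in> borel_measurable borel" "finite (range z)" "\<alpha> = distr \<mu> borel z"
    "strict_mono_on {x. 0 < measure \<mu> {x}} z"
    "distr (\<mu> \<Otimes>\<^sub>M q) borel (\<lambda>(x, y). real_of_ereal (bass_map q \<nu> \<alpha> (z x + y))) = \<nu>"
    "\<And>x. 0 < measure \<mu> {x} \<Longrightarrow> star_defined q (bass_map q \<nu> \<alpha>) (z x)"
    "\<And>x. 0 < measure \<mu> {x} \<Longrightarrow> star q (bass_map q \<nu> \<alpha>) (z x) = x"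
    using bass_measure_positions[OF assms(1-3) fin atomic bass(1)] by blast
  obtain z' where z': "z' \<in> borel_measurable borel" "finite (range z')" "\<alpha>' = distr \<mu> borel z'"
    "strict_mono_on {x. 0 < measure \<mu> {x}} z'"
    "distr (\<mu> \<Otimes>\<^sub>M q) borel (\<lambda>(x, y). real_of_ereal (bass_map q \<nu> \<alpha>' (z' x + y))) = \<nu>"
    "\<And>x. 0 < measure \<mu> {x} \<Longrightarrow> star_defined q (bass_map q \<nu> \<alpha>') (z' x)"
    "\<And>x. 0 < measure \<mu> {x} \<Longrightarrow> star q (bass_map q \<nu> \<alpha>') (z' x) = x"
    using bass_measure_positions[OF assms(1-3) fin atomic bass(2)] by blast
  interpret two_bass_solutions \<mu> \<nu> q a b z z'
  proof (unfold two_bass_solutions_def, intro conjI)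
    show "bass_solution \<mu> \<nu> q a b z"
      by unfold_locales (use z in \<open>simp_all add: finite_imp_bounded\<close>)
    show "bass_solution \<mu> \<nu> q a b z'"
      by unfold_locales (use z' in \<open>simp_all add: finite_imp_bounded\<close>)
  qed
  obtain c where c: "\<And>x. 0 < measure \<mu> {x} \<Longrightarrow> z' x = z x + c"
    using same_displacement[OF A2(2) irreducible fin] by blast
  have "\<alpha>' = distr \<mu> borel (\<lambda>x. z x + c)"
    unfolding z'(3) by (rule distr_cong_AE) (use atomic c z(1) z'(1) in \<open>auto elim!: eventually_mono\<close>)
  also have "\<dots> = distr \<alpha> borel (\<lambda>x. x + c)"
    unfolding z(3) using z(1) by (subst distr_distr) (auto simp: comp_def)
  finally show "\<exists>c. \<alpha>' = distr \<alpha> borel (\<lambda>x. x + c)" ..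
qed

end
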